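(* For each $r\in\mathbb{N}$, each integer $\Delta\ge 2$ and each $n\in\mathbb{N}$, there exists a graph which contains no subgraph isomorphic to $K_{2\Delta,2\Delta}$ and is $r$-partition universal for $\mathcal{H}(n,\Delta)$.
   Context: $\mathcal{H}(n,\Delta)$ is the class of $n$-vertex graphs with maximum degree at most $\Delta$. A graph $G$ is $r$-partition universal for $\mathcal{H}$ if for every colouring of $E(G)$ with $r$ colours some colour class contains a copy of every $H\in\mathcal{H}$ as a subgraph. $K_{s,t}$ is the complete bipartite graph with parts of sizes $s$ and $t$. *)

theory Defs
  imports Main "HOL-Library.FuncSet"
begin

datatype 'a graph = Graph (verts: "'a set") (edges: "'a set set")

definition finite_simple_graph :: "'a graph \<Rightarrow> bool" where
  "finite_simple_graph G \<longleftrightarrow>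
     finite (verts G) \<and> (\<forall>e\<in>edges G. e \<subseteq> verts G \<and> card e = 2)"

definition degree :: "'a graph \<Rightarrow> 'a \<Rightarrow> nat" where
  "degree G v = card {e \<in> edges G. v \<in> e}"

(* Inserting 0 only matters for the graph without vertices. *)
definition max_degree :: "'a graph \<Rightarrow> nat" where
  "max_degree G = Max (insert 0 (degree G ` verts G))"

definition subgraph :: "'a graph \<Rightarrow> 'a graph \<Rightarrow> bool" where
  "subgraph S G \<longleftrightarrow>
     finite_simple_graph S \<and> verts S \<subseteq> verts G \<and> edges S \<subseteq> edges G"

definition isomorphic :: "'a graph \<Rightarrow> 'b graph \<Rightarrow> bool" where
  "isomorphic G H \<longleftrightarrow>
     (\<exists>f. bij_betw f (verts G) (verts H) \<and> (\<lambda>e. f ` e) ` edges G = edges H)"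

(* The subgraph need not be induced. *)
definition contains_copy :: "'a graph \<Rightarrow> 'b graph \<Rightarrow> bool" where
  "contains_copy G H \<longleftrightarrow> (\<exists>S. subgraph S G \<and> isomorphic S H)"

definition complete_bipartite :: "nat \<Rightarrow> nat \<Rightarrow> (nat + nat) graph" where
  "complete_bipartite s t =
     Graph ({..<s} <+> {..<t}) {{Inl i, Inr j} | i j. i < s \<and> j < t}"

(* Every finite graph is isomorphic to one with vertices in nat, so taking nat as the
   vertex type represents all isomorphism types of n-vertex graphs. *)
definition bounded_degree_graphs :: "nat \<Rightarrow> nat \<Rightarrow> nat graph set" where
  "bounded_degree_graphs n \<Delta> =
     {H. finite_simple_graph H \<and> card (verts H) = n \<and> max_degree H \<le> \<Delta>}"

definition colour_class :: "'a graph \<Rightarrow> ('a set \<Rightarrow> nat) \<Rightarrow> nat \<Rightarrow> 'a graph" where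
  "colour_class G c i = Graph (verts G) {e \<in> edges G. c e = i}"

(* One colour class has to contain all members of the family simultaneously. *)
definition partition_universal :: "nat \<Rightarrow> 'a graph \<Rightarrow> 'b graph set \<Rightarrow> bool" where
  "partition_universal r G \<H> \<longleftrightarrow>
     (\<forall>c \<in> edges G \<rightarrow> {..<r}. \<exists>i<r. \<forall>H\<in>\<H>. contains_copy (colour_class G c i) H)"

end

theory Submission
  imports Defs Complex_Main "HOL-Library.Ramsey"
begin

text \<open>
  Hypergraph containers replace the colour classes. Let \<open>H\<close> have \<open>n\<close> vertices and maximum
  degree \<open>\<Delta>\<close>. The hypergraph on the pairs of \<open>{..<N}\<close> whose edges are the copies of \<open>H\<close> has codegrees
  small enough that every \<open>H\<close>-free graph lies in one of only \<open>exp (O (N powr (2 - 1/\<Delta>) * ln N))\<close>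
  containers, each with few copies of \<open>H\<close> and hence with few copies of the clique on \<open>n\<close> vertices. By
  Ramsey's theorem and averaging, \<open>r\<close> such containers miss a positive proportion of all pairs. A random
  graph whose density exceeds \<open>N powr (-1/\<Delta>)\<close> by a small power of \<open>N\<close> therefore meets, in many edges,
  the complement of any union of \<open>r\<close> containers, so none of its \<open>r\<close>-colourings can avoid the family. At
  this density there are far fewer copies of the biclique than edges, and deleting an edge from each
  copy does no harm.
\<close>

subsection \<open>Hypergraph containers\<close>

text \<open>Different colours may miss different members of the family, so a container has to be
  measured by something that does not depend on the missed graph. Cliques serve: every graph on n
  vertices lies in the clique, so few copies of any one of them force few cliques. The exponent
  1/\<Delta> comes from the inequality e - 1 \<le> \<Delta> (v - 2) for e \<ge> 1 edges spanning v
  vertices with degrees at most \<Delta> \<ge> 2. A set of e pairs on v points lies in O(N^(n - v))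
  copies, which is smaller than the order N^(n - 2) allowed for a single pair by a factor of at
  least N^((e - 1)/\<Delta>). This is the codegree condition for \<tau> = N^(-1/\<Delta>). The same
  exponent dictates the biclique: K_{t,t} has about N^(2t) p^(t^2) expected copies, and at p =
  N^(-1/\<Delta>) this is of constant order for t = 2\<Delta>, against p N^2 expected edges. This
  gap leaves room for the small power of N by which p is raised, and p has to be raised because the
  number of containers has a factor ln N in its exponent.\<close>

definition wdeg :: "'a set \<Rightarrow> ('a set \<Rightarrow> real) \<Rightarrow> 'a set \<Rightarrow> real" where
  "wdeg V w s = (\<Sum>f | f \<subseteq> V \<and> s \<subseteq> f. w f)"

text \<open>Real weights in place of a set of edges: summing links creates multiplicities, and
  distinct embeddings may yield the same copy. An independent set is one on whose subsets the weight
  vanishes.\<close>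

definition uniform_weight :: "'a set \<Rightarrow> nat \<Rightarrow> ('a set \<Rightarrow> real) \<Rightarrow> bool" where
  "uniform_weight V k w \<longleftrightarrow> (\<forall>f. 0 \<le> w f) \<and> (\<forall>f. w f \<noteq> 0 \<longrightarrow> f \<subseteq> V \<and> card f = k)"

text \<open>
  A \<open>(k + 1)\<close>-uniform weight \<open>w\<close> is reduced to a \<open>k\<close>-uniform weight \<open>u\<close> by adding up links of vertices of
  the independent set at hand. To keep the degrees of \<open>u\<close> small, a set counts as saturated once its
  degree reaches \<open>\<tau> ^ card s * D\<close>, and links contribute only edges without saturated subsets: a single
  link adds at most that amount again, so the degrees stay below twice the threshold.
\<close>

definition saturated :: "'a set \<Rightarrow> real \<Rightarrow> real \<Rightarrow> ('a set \<Rightarrow> real) \<Rightarrow> 'a set set" where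
  "saturated V \<tau> D u = {s. s \<subseteq> V \<and> s \<noteq> {} \<and> \<tau> ^ card s * D \<le> wdeg V u s}"

definition free_link ::
  "'a set \<Rightarrow> real \<Rightarrow> real \<Rightarrow> ('a set \<Rightarrow> real) \<Rightarrow> ('a set \<Rightarrow> real) \<Rightarrow> 'a \<Rightarrow> 'a set \<Rightarrow> real" where
  "free_link V \<tau> D w u v f =
     (if v \<in> V \<and> v \<notin> f \<and> f \<subseteq> V \<and> (\<forall>s \<in> saturated V \<tau> D u. \<not> s \<subseteq> f) then w (insert v f) else 0)"

lemma finite_supersets: "finite V \<Longrightarrow> finite {f. f \<subseteq> V \<and> s \<subseteq> f}"
  by (rule finite_subset[of _ "Pow V"]) auto

lemma wdeg_alt: "finite V \<Longrightarrow> wdeg V w s = (\<Sum>f\<in>Pow V. if s \<subseteq> f then w f else 0)"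
  unfolding wdeg_def by (subst sum.inter_filter[symmetric]) (auto intro!: sum.cong)

lemma wdeg_nonneg: "uniform_weight V k w \<Longrightarrow> 0 \<le> wdeg U w s"
  by (auto simp: wdeg_def uniform_weight_def intro: sum_nonneg)

lemma wdeg_add: "wdeg V (\<lambda>f. a f + b f) s = wdeg V a s + wdeg V b s"
  by (simp add: wdeg_def sum.distrib)

lemma free_link_nonneg: "uniform_weight V k w \<Longrightarrow> 0 \<le> free_link V \<tau> D w u v f"
  by (auto simp: free_link_def uniform_weight_def)

lemma uniform_free_link:
  assumes "finite V" "uniform_weight V (Suc k) w"
  shows "uniform_weight V k (free_link V \<tau> D w u v)"
proof -
  have "f \<subseteq> V \<and> card f = k" if "free_link V \<tau> D w u v f \<noteq> 0" for f
  proof -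
    have *: "v \<notin> f" "f \<subseteq> V" "w (insert v f) \<noteq> 0"
      using that by (auto simp: free_link_def split: if_splits)
    then have "card (insert v f) = Suc k" using assms by (auto simp: uniform_weight_def)
    then show ?thesis using * assms(1) by (auto simp: finite_subset)
  qed
  then show ?thesis using free_link_nonneg[OF assms(2)] by (auto simp: uniform_weight_def)
qed

text \<open>Inserting \<open>v\<close> is injective on edges avoiding \<open>v\<close>. The spread
  of \<open>w\<close> at \<open>insert v s\<close> therefore limits what one link can add at
  \<open>s\<close>.\<close>

lemma wdeg_free_link_le:
  assumes "finite V" "uniform_weight V (Suc k) w"
  shows "wdeg V (free_link V \<tau> D w u v) s \<le> wdeg V w (insert v s)"
proof -
  let ?F = "{f. f \<subseteq> V \<and> s \<subseteq> f}" and ?G = "{f. f \<subseteq> V \<and> s \<subseteq> f \<and> v \<in> V \<and> v \<notin> f}"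
  have "wdeg V (free_link V \<tau> D w u v) s = (\<Sum>f\<in>?G. free_link V \<tau> D w u v f)"
    unfolding wdeg_def
    by (rule sum.mono_neutral_right) (auto simp: finite_supersets[OF assms(1)] free_link_def)
  also have "\<dots> \<le> (\<Sum>f\<in>?G. w (insert v f))"
    using assms(2) by (intro sum_mono) (auto simp: free_link_def uniform_weight_def)
  also have "\<dots> = sum w (insert v ` ?G)"
    by (subst sum.reindex) (auto simp: inj_on_def)
  also have "\<dots> \<le> wdeg V w (insert v s)"
    unfolding wdeg_def using assms
    by (intro sum_mono2) (auto simp: finite_supersets uniform_weight_def)
  finally show ?thesis .
qed

lemma wdeg_free_link_eq_0:
  assumes "v \<in> s \<or> v \<notin> V \<or> s \<in> saturated V \<tau> D u"
  shows "wdeg V (free_link V \<tau> D w u v) s = 0"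
  unfolding wdeg_def using assms by (intro sum.neutral) (auto simp: free_link_def)

section \<open>Double counting of saturated sets and free links\<close>

text \<open>Each edge contributes its weight once for each of its \<open>2 ^ k\<close>
  subsets.\<close>

lemma sum_wdeg_eq:
  assumes "finite V" "uniform_weight V k u"
  shows "(\<Sum>s\<in>Pow V. wdeg V u s) = 2 ^ k * wdeg V u {}"
proof -
  have "(\<Sum>s\<in>Pow V. wdeg V u s) = (\<Sum>s\<in>Pow V. \<Sum>f\<in>Pow V. if s \<subseteq> f then u f else 0)"
    by (simp add: wdeg_alt[OF assms(1)])
  also have "\<dots> = (\<Sum>f\<in>Pow V. \<Sum>s\<in>Pow V. if s \<subseteq> f then u f else 0)"
    by (rule sum.swap)
  also have "\<dots> = (\<Sum>f\<in>Pow V. 2 ^ k * u f)"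
  proof (intro sum.cong refl)
    fix f assume f: "f \<in> Pow V"
    have "{s \<in> Pow V. s \<subseteq> f} = Pow f" using f by auto
    then have "(\<Sum>s\<in>Pow V. if s \<subseteq> f then u f else 0) = (\<Sum>s\<in>Pow f. u f)"
      using assms(1) by (subst sum.inter_filter[symmetric]) (auto simp del: sum_constant)
    also have "\<dots> = 2 ^ card f * u f"
      using f assms(1) by (simp add: card_Pow finite_subset)
    also have "\<dots> = 2 ^ k * u f"
      using assms(2) by (cases "u f = 0") (auto simp: uniform_weight_def)
    finally show "(\<Sum>s\<in>Pow V. if s \<subseteq> f then u f else 0) = 2 ^ k * u f" .
  qed
  finally show ?thesis by (simp add: wdeg_def sum_distrib_left Pow_def)
qed

text \<open>An edge without saturated subsets reappears, with a vertex removed, in the free link of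
  that vertex. One chosen vertex \<open>c f\<close> per edge suffices, because the pair
  \<open>(c f, f - {c f})\<close> determines \<open>f\<close>; this gives away a factor
  \<open>Suc k\<close>.\<close>

lemma sum_free_link_ge:
  assumes V: "finite V" and w: "uniform_weight V (Suc k) w"
  shows "(\<Sum>f | f \<subseteq> V \<and> (\<forall>s\<in>saturated V \<tau> D u. \<not> s \<subseteq> f). w f)
           \<le> (\<Sum>v\<in>V. wdeg V (free_link V \<tau> D w u v) {})"
proof -
  let ?A = "{f. f \<subseteq> V \<and> (\<forall>s\<in>saturated V \<tau> D u. \<not> s \<subseteq> f)}"
  let ?B = "{f \<in> ?A. f \<noteq> {}}"
  define c where "c f = (SOME v. v \<in> f)" for f :: "'a set"
  have c: "c f \<in> f" if "f \<noteq> {}" for f using that unfolding c_def by (simp add: some_in_eq)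
  have fin: "finite ?A" by (rule finite_subset[of _ "Pow V"]) (use V in auto)
  \<comment> \<open>The empty set has weight zero as the uniformity is \<open>Suc k\<close>, so
    every edge that matters has a vertex to choose.\<close>
  have "sum w ?A = sum w ?B"
    using fin w by (intro sum.mono_neutral_right) (auto simp: uniform_weight_def)
  also have "\<dots> = (\<Sum>f\<in>?B. case (c f, f - {c f}) of (v, g) \<Rightarrow> free_link V \<tau> D w u v g)"
  proof (intro sum.cong refl)
    fix f assume f: "f \<in> ?B"
    then have "insert (c f) (f - {c f}) = f" using c by auto
    moreover have "c f \<in> V" using f c by auto
    ultimately show "w f = (case (c f, f - {c f}) of (v, g) \<Rightarrow> free_link V \<tau> D w u v g)"
      using f by (auto simp: free_link_def)
  qed
  also have "\<dots> = (\<Sum>(v, g)\<in>(\<lambda>f. (c f, f - {c f})) ` ?B. free_link V \<tau> D w u v g)"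
  proof -
    have "inj_on (\<lambda>f. (c f, f - {c f})) ?B"
    proof (rule inj_onI)
      fix f g assume "f \<in> ?B" "g \<in> ?B" and eq: "(c f, f - {c f}) = (c g, g - {c g})"
      then have "f \<noteq> {}" "g \<noteq> {}" by simp_all
      then have ins: "insert (c f) (f - {c f}) = f" "insert (c g) (g - {c g}) = g"
        by (simp_all add: insert_absorb c)
      have "insert (c f) (f - {c f}) = insert (c g) (g - {c g})"
        using arg_cong[OF eq, of "\<lambda>(a, b). insert a b"] by (simp only: prod.case)
      then show "f = g" by (simp only: ins)
    qed
    then show ?thesis by (subst sum.reindex) (simp_all only: o_def)
  qed
  also have "\<dots> \<le> (\<Sum>(v, g)\<in>V \<times> Pow V. free_link V \<tau> D w u v g)"
  proof (rule sum_mono2)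
    show "(\<lambda>f. (c f, f - {c f})) ` ?B \<subseteq> V \<times> Pow V" using c by blast
  qed (use V free_link_nonneg[OF w] in auto)
  also have "\<dots> = (\<Sum>v\<in>V. wdeg V (free_link V \<tau> D w u v) {})"
    by (simp add: sum.cartesian_product wdeg_def Pow_def)
  finally show ?thesis .
qed

text \<open>The loss caused by saturated sets is controlled by \<open>u\<close>. Each lost edge is
  charged to a saturated subset \<open>s\<close>. There \<open>w\<close> has degree at most
  \<open>\<tau> ^ (card s - 1) * D\<close>, while saturation gives \<open>u\<close> degree at least
  \<open>\<tau> ^ card s * D\<close>. Hence the loss is at most the sum of all degrees of
  \<open>u\<close> divided by \<open>\<tau>\<close>, and a light \<open>u\<close> costs
  little.\<close>

lemma sum_saturated_le:
  assumes V: "finite V" and w: "uniform_weight V l w" and u: "uniform_weight V k u"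
    and \<tau>: "0 < \<tau>" and D: "0 < D"
    and spread: "\<And>s. s \<subseteq> V \<Longrightarrow> s \<noteq> {} \<Longrightarrow> wdeg V w s \<le> \<tau> ^ (card s - 1) * D"
  shows "wdeg V w {} - 2 ^ k * wdeg V u {} / \<tau>
           \<le> (\<Sum>f | f \<subseteq> V \<and> (\<forall>s\<in>saturated V \<tau> D u. \<not> s \<subseteq> f). w f)"
proof -
  let ?S = "saturated V \<tau> D u"
  let ?A = "{f. f \<subseteq> V \<and> (\<forall>s\<in>?S. \<not> s \<subseteq> f)}"
  have S: "?S \<subseteq> Pow V" by (auto simp: saturated_def)
  then have finS: "finite ?S" using V finite_subset by blast
  have w0: "\<And>f. 0 \<le> w f" using w by (auto simp: uniform_weight_def)
  have "wdeg V w {} = sum w (Pow V)" by (simp add: wdeg_def Pow_def)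
  also have "\<dots> = sum w ?A + sum w (Pow V - ?A)"
    using V by (subst add.commute, intro sum.subset_diff) auto
  also have "sum w (Pow V - ?A) \<le> (\<Sum>f\<in>Pow V - ?A. \<Sum>s\<in>?S. if s \<subseteq> f then w f else 0)"
  proof (intro sum_mono)
    fix f assume "f \<in> Pow V - ?A"
    then obtain s where "s \<in> ?S" "s \<subseteq> f" by auto
    then show "w f \<le> (\<Sum>s\<in>?S. if s \<subseteq> f then w f else 0)"
      using member_le_sum[of s ?S "\<lambda>s. if s \<subseteq> f then w f else 0"] finS w0 by auto
  qed
  also have "\<dots> \<le> (\<Sum>f\<in>Pow V. \<Sum>s\<in>?S. if s \<subseteq> f then w f else 0)"
    using V w0 by (intro sum_mono2 sum_nonneg) auto
  also have "\<dots> = (\<Sum>s\<in>?S. wdeg V w s)"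
    by (subst sum.swap) (simp add: wdeg_alt[OF V])
  also have "\<dots> \<le> (\<Sum>s\<in>?S. wdeg V u s / \<tau>)"
  proof (intro sum_mono)
    fix s assume s: "s \<in> ?S"
    then have "s \<subseteq> V" "s \<noteq> {}" "finite s" and le: "\<tau> ^ card s * D \<le> wdeg V u s"
      using V finite_subset by (auto simp: saturated_def)
    then have "card s = Suc (card s - 1)" by (simp add: card_gt_0_iff)
    then have "\<tau> * (\<tau> ^ (card s - 1) * D) \<le> wdeg V u s"
      using le by (metis mult.assoc power_Suc)
    then have "\<tau> ^ (card s - 1) * D \<le> wdeg V u s / \<tau>"
      using \<tau> by (simp add: field_simps)
    then show "wdeg V w s \<le> wdeg V u s / \<tau>"
      using spread[OF \<open>s \<subseteq> V\<close> \<open>s \<noteq> {}\<close>] by linarith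
  qed
  also have "\<dots> \<le> (\<Sum>s\<in>Pow V. wdeg V u s / \<tau>)"
    using S V \<tau> wdeg_nonneg[OF u] by (intro sum_mono2) auto
  also have "\<dots> = 2 ^ k * wdeg V u {} / \<tau>"
    using sum_wdeg_eq[OF V u] by (simp add: sum_divide_distrib[symmetric])
  finally show ?thesis by simp
qed

section \<open>Sums of links along vertex sequences\<close>

primrec link_states :: "'a set \<Rightarrow> real \<Rightarrow> real \<Rightarrow> ('a set \<Rightarrow> real) \<Rightarrow> nat \<Rightarrow> ('a set \<Rightarrow> real) set" where
  "link_states V \<tau> D w 0 = {\<lambda>_. 0}"
| "link_states V \<tau> D w (Suc i) =
     (\<Union>v\<in>V. (\<lambda>u f. u f + free_link V \<tau> D w u v f) ` link_states V \<tau> D w i)"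

lemma finite_link_states: "finite V \<Longrightarrow> finite (link_states V \<tau> D w i)"
  by (induction i) auto

text \<open>A state is determined by the sequence of vertices whose links were added. No independent
  set enters the definition of the states, so this count serves all of them at once.\<close>

lemma card_link_states_le: "finite V \<Longrightarrow> card (link_states V \<tau> D w i) \<le> card V ^ i"
proof (induction i)
  case (Suc i)
  have "card (link_states V \<tau> D w (Suc i))
          \<le> (\<Sum>v\<in>V. card ((\<lambda>u f. u f + free_link V \<tau> D w u v f) ` link_states V \<tau> D w i))"
    using Suc.prems by (simp add: card_UN_le)
  also have "\<dots> \<le> (\<Sum>v\<in>V. card V ^ i)"
    using Suc finite_link_states[OF Suc.prems] by (intro sum_mono) (meson card_image_le order_trans)
  finally show ?case by simp
qed simp

text \<open>Read as \<open>\<tau> ^ (card s - 1) * (2 * \<tau> * D)\<close>, the bound on the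
  degrees is the spread condition one uniformity lower, with \<open>2 * \<tau> * D\<close> in place
  of \<open>D\<close>. This is what allows an induction on the uniformity.\<close>

lemma link_states_invariant:
  assumes V: "finite V" and w: "uniform_weight V (Suc k) w"
    and \<tau>: "0 < \<tau>" and D: "0 < D"
    and spread: "\<And>s. s \<subseteq> V \<Longrightarrow> s \<noteq> {} \<Longrightarrow> wdeg V w s \<le> \<tau> ^ (card s - 1) * D"
    and u: "u \<in> link_states V \<tau> D w i"
  shows "uniform_weight V k u"
    and "\<And>s. s \<subseteq> V \<Longrightarrow> s \<noteq> {} \<Longrightarrow> wdeg V u s \<le> \<tau> ^ card s * (2 * D)"
proof -
  have "uniform_weight V k u \<and> (\<forall>s. s \<subseteq> V \<and> s \<noteq> {} \<longrightarrow> wdeg V u s \<le> \<tau> ^ card s * (2 * D))"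
    using u
  proof (induction i arbitrary: u)
    case 0
    then show ?case using \<tau> D by (auto simp: uniform_weight_def wdeg_def)
  next
    case (Suc i)
    then obtain v u0 where v: "v \<in> V" and u0: "u0 \<in> link_states V \<tau> D w i"
      and u: "u = (\<lambda>f. u0 f + free_link V \<tau> D w u0 v f)" by auto
    have un: "uniform_weight V k u0" and le: "\<And>s. s \<subseteq> V \<Longrightarrow> s \<noteq> {} \<Longrightarrow> wdeg V u0 s \<le> \<tau> ^ card s * (2 * D)"
      using Suc.IH[OF u0] by auto
    have "uniform_weight V k u"
      using un uniform_free_link[OF V w, of \<tau> D u0 v] unfolding u uniform_weight_def
      by (metis add_cancel_left_right add_nonneg_nonneg)
    moreover have "wdeg V u s \<le> \<tau> ^ card s * (2 * D)" if s: "s \<subseteq> V" "s \<noteq> {}" for s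
    proof (cases "v \<in> s \<or> s \<in> saturated V \<tau> D u0")
      case True
      then have "wdeg V (free_link V \<tau> D w u0 v) s = 0" by (intro wdeg_free_link_eq_0) auto
      then show ?thesis using le[OF s] by (simp add: u wdeg_add)
    next
      case False
      then have "wdeg V u0 s \<le> \<tau> ^ card s * D" using s by (auto simp: saturated_def)
      \<comment> \<open>As \<open>v \<notin> s\<close>, the exponent
        \<open>card (insert v s) - 1\<close> is \<open>card s\<close>: the spread condition and the
        saturation threshold match.\<close>
      moreover have "wdeg V w (insert v s) \<le> \<tau> ^ card s * D"
        using spread[of "insert v s"] s v V False by (auto simp: finite_subset)
      ultimately show ?thesis
        using wdeg_free_link_le[OF V w, of \<tau> D u0 v s] by (simp add: u wdeg_add)
    qed
    ultimately show ?case by blast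
  qed
  then show "uniform_weight V k u"
    "\<And>s. s \<subseteq> V \<Longrightarrow> s \<noteq> {} \<Longrightarrow> wdeg V u s \<le> \<tau> ^ card s * (2 * D)" by auto
qed

text \<open>A greedy choice: as long as some vertex of \<open>I\<close> has a free link of weight at
  least \<open>a\<close>, that link is added. After \<open>i\<close> rounds the weight is at least
  \<open>i * a\<close>, so \<open>L\<close> rounds reach \<open>M\<close> unless the process stops
  earlier. The set \<open>I\<close> stays independent, because \<open>v \<in> I\<close> and
  \<open>f \<subseteq> I\<close> give \<open>insert v f \<subseteq> I\<close>.\<close>

lemma link_state_dichotomy:
  assumes V: "finite V" and I: "I \<subseteq> V" "\<And>f. f \<subseteq> I \<Longrightarrow> w f = 0"
    and M: "M \<le> real L * a"
  shows "\<exists>i\<le>L. \<exists>u\<in>link_states V \<tau> D w i. (\<forall>f. f \<subseteq> I \<longrightarrow> u f = 0) \<and>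
           (M \<le> wdeg V u {} \<or>
            wdeg V u {} < M \<and> (\<forall>v\<in>I. wdeg V (free_link V \<tau> D w u v) {} < a))"
proof (rule ccontr)
  assume neg: "\<not> ?thesis"
  have "\<exists>u\<in>link_states V \<tau> D w i. (\<forall>f. f \<subseteq> I \<longrightarrow> u f = 0) \<and> real i * a \<le> wdeg V u {}"
    if "i \<le> L" for i using that
  proof (induction i)
    case 0
    then show ?case by (simp add: wdeg_def)
  next
    case (Suc i)
    then obtain u where u: "u \<in> link_states V \<tau> D w i" and ind: "\<And>f. f \<subseteq> I \<Longrightarrow> u f = 0"
      and le: "real i * a \<le> wdeg V u {}" by auto
    then obtain v where v: "v \<in> I" "a \<le> wdeg V (free_link V \<tau> D w u v) {}"
      using neg Suc.prems by (meson Suc_leD linorder_not_less)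
    let ?u = "\<lambda>f. u f + free_link V \<tau> D w u v f"
    have "?u \<in> link_states V \<tau> D w (Suc i)" using u v I by auto
    moreover have "\<forall>f. f \<subseteq> I \<longrightarrow> ?u f = 0" using ind v I by (auto simp: free_link_def)
    moreover have "real (Suc i) * a \<le> wdeg V ?u {}"
      using le v by (simp add: wdeg_add algebra_simps)
    ultimately show ?case by (intro bexI[of _ ?u] conjI)
  qed
  from this[OF order_refl] obtain u where "u \<in> link_states V \<tau> D w L" "\<forall>f. f \<subseteq> I \<longrightarrow> u f = 0"
    "real L * a \<le> wdeg V u {}" by (elim bexE conjE)
  moreover from this(3) M have "M \<le> wdeg V u {}" by linarith
  ultimately show False using neg order_refl[of L] by blast
qed

lemma sum_power_le: "(\<Sum>i\<le>L. m ^ i) \<le> (m + 1 :: nat) ^ L"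
proof (induction L)
  case (Suc L)
  have "m ^ Suc L \<le> m * (m + 1) ^ L" by (simp add: power_mono)
  then have "(\<Sum>i\<le>Suc L. m ^ i) \<le> (m + 1) ^ L + m * (m + 1) ^ L"
    using Suc by (simp only: sum.atMost_Suc)
  then show ?case by simp
qed simp

section \<open>Container families and their refinement\<close>

definition container_family :: "'a set \<Rightarrow> ('a set \<Rightarrow> real) \<Rightarrow> 'a set set \<Rightarrow> bool" where
  "container_family V w \<C> \<longleftrightarrow> finite \<C> \<and> (\<forall>C\<in>\<C>. C \<subseteq> V) \<and>
     (\<forall>I. I \<subseteq> V \<longrightarrow> (\<forall>f. f \<subseteq> I \<longrightarrow> w f = 0) \<longrightarrow> (\<exists>C\<in>\<C>. I \<subseteq> C))"

text \<open>
  If no vertex of the independent set has a heavy free link, the vertices with heavy free links can be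
  removed from the container. Otherwise adding links eventually produces a heavy weight of smaller
  uniformity. The number of links added bounds the number of outcomes, and this is all that the union
  bound needs; hence no fingerprints are recorded.
\<close>

lemma container_step:
  fixes \<epsilon> :: real
  assumes "0 < \<epsilon>"
  shows "\<exists>\<delta>>0. \<forall>(V :: 'a set) w \<tau> D n L.
    finite V \<longrightarrow> card V \<le> n \<longrightarrow> 1 \<le> n \<longrightarrow> 0 < \<tau> \<longrightarrow> 0 < D \<longrightarrow> 2 * \<tau> * real n + 1 \<le> real L \<longrightarrow>
    uniform_weight V k w \<longrightarrow>
    (\<forall>s. s \<subseteq> V \<longrightarrow> s \<noteq> {} \<longrightarrow> wdeg V w s \<le> \<tau> ^ (card s - 1) * D) \<longrightarrow>
    \<epsilon> * D * real n \<le> wdeg V w {} \<longrightarrow>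
    (\<exists>\<C>. container_family V w \<C> \<and> card \<C> \<le> (n + 1) ^ (2 * k * L) \<and>
       (\<forall>C\<in>\<C>. real (card C) + \<delta> * real n \<le> real (card V)))"
    (is "\<exists>\<delta>>0. \<forall>V w \<tau> D n L. ?P k \<epsilon> \<delta> V w \<tau> D n L")
  using assms
proof (induction k arbitrary: \<epsilon>)
  case 0
  have "?P 0 \<epsilon> 1 V w \<tau> D n L" for V w \<tau> D n L
  proof (intro impI)
    assume V: "finite V" and n: "1 \<le> n" and D: "0 < D" and w: "uniform_weight V 0 w"
      and tot: "\<epsilon> * D * real n \<le> wdeg V w {}"
    have "0 < wdeg V w {}" using n D 0 tot by (meson less_le_trans mult_pos_pos of_nat_0_less_iff zero_less_one)
    then obtain f where "f \<subseteq> V" "w f \<noteq> 0"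
      unfolding wdeg_def by (metis (mono_tags, lifting) less_irrefl mem_Collect_eq sum.neutral)
    \<comment> \<open>The empty set is now an edge inside every set, so no set is independent and
      the empty family covers vacuously.\<close>
    then have "w {} \<noteq> 0" using w V by (metis card_0_eq finite_subset uniform_weight_def)
    then show "\<exists>\<C>. container_family V w \<C> \<and> card \<C> \<le> (n + 1) ^ (2 * 0 * L) \<and>
       (\<forall>C\<in>\<C>. real (card C) + 1 * real n \<le> real (card V))"
      by (intro exI[of _ "{}"]) (auto simp: container_family_def)
  qed
  then show ?case by (intro exI[of _ 1]) auto
next
  case (Suc k)
  \<comment> \<open>Chosen such that \<open>2 ^ k * M / \<tau>\<close>, the loss to saturated sets
    when \<open>u\<close> weighs less than \<open>M\<close>, is half of the assumed total
    weight.\<close>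
  define \<epsilon>' where "\<epsilon>' = \<epsilon> / 2 ^ (k + 2)"
  have \<epsilon>': "0 < \<epsilon>'" using Suc.prems by (simp add: \<epsilon>'_def)
  obtain \<delta>' where \<delta>'_IH: "0 < \<delta>' \<and> (\<forall>V w \<tau> D n L. ?P k \<epsilon>' \<delta>' V w \<tau> D n L)"
    using Suc.IH[OF \<epsilon>'] by (rule exE)
  then have \<delta>': "0 < \<delta>'" by (rule conjunct1)
  note IH = \<delta>'_IH[THEN conjunct2]
  \<comment> \<open>The first entry serves the containers of the induction hypothesis, the second
    those obtained by deleting the vertices with heavy links.\<close>
  define \<delta> where "\<delta> = min \<delta>' (\<epsilon> / 4)"
  have main: "?P (Suc k) \<epsilon> \<delta> V w \<tau> D n L" for V w \<tau> D n L
  proof (intro impI)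
    assume V: "finite V" and n: "card V \<le> n" "1 \<le> n" and \<tau>: "0 < \<tau>" and D: "0 < D"
      and L: "2 * \<tau> * real n + 1 \<le> real L" and w: "uniform_weight V (Suc k) w"
      and spread: "\<forall>s. s \<subseteq> V \<longrightarrow> s \<noteq> {} \<longrightarrow> wdeg V w s \<le> \<tau> ^ (card s - 1) * D"
      and tot: "\<epsilon> * D * real n \<le> wdeg V w {}"
    \<comment> \<open>The total weight that the induction hypothesis demands for
      \<open>\<epsilon>'\<close> and \<open>2 * \<tau> * D\<close>; it is used with unchanged
      \<open>\<tau>\<close>, \<open>n\<close> and \<open>L\<close>.\<close>
    define M where "M = \<epsilon>' * (2 * \<tau> * D) * real n"
    \<comment> \<open>Links below \<open>a\<close> account for at most half of the weight
      \<open>\<epsilon> / 2 * D * n\<close> that remains. A single link weighs at most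
      \<open>D\<close>, so the other half needs \<open>\<epsilon> / 4 * n\<close> vertices. At the
      same time \<open>a\<close> is large enough for \<open>L\<close> links to reach
      \<open>M\<close>.\<close>
    define a where "a = \<epsilon> / 4 * D"
    define R where "R = (\<Union>i\<le>L. link_states V \<tau> D w i)"
    define B where "B u = {v \<in> V. a \<le> wdeg V (free_link V \<tau> D w u v) {}}" for u
    have finR: "finite R" unfolding R_def using V by (simp add: finite_link_states)
    have "card R \<le> (\<Sum>i\<le>L. card (link_states V \<tau> D w i))"
      unfolding R_def by (intro card_UN_le) auto
    also have "\<dots> \<le> (\<Sum>i\<le>L. n ^ i)"
      using n by (intro sum_mono order_trans[OF card_link_states_le[OF V]] power_mono) auto
    also have "\<dots> \<le> (n + 1) ^ L" by (rule sum_power_le)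
    finally have cardR: "card R \<le> (n + 1) ^ L" .
    have inv: "uniform_weight V k u"
        "\<And>s. s \<subseteq> V \<Longrightarrow> s \<noteq> {} \<Longrightarrow> wdeg V u s \<le> \<tau> ^ card s * (2 * D)" if "u \<in> R" for u
      using link_states_invariant[OF V w \<tau> D] spread that unfolding R_def by blast+
    have "\<exists>\<C>. container_family V u \<C> \<and> card \<C> \<le> (n + 1) ^ (2 * k * L) \<and>
       (\<forall>C\<in>\<C>. real (card C) + \<delta>' * real n \<le> real (card V))"
      if u: "u \<in> R" "M \<le> wdeg V u {}" for u
    proof -
      have "wdeg V u s \<le> \<tau> ^ (card s - 1) * (2 * \<tau> * D)" if s: "s \<subseteq> V" "s \<noteq> {}" for s
      proof -
        have "card s \<noteq> 0" using s(2) finite_subset[OF s(1) V] by simp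
        then have "\<tau> ^ card s = \<tau> ^ (card s - 1) * \<tau>" by (metis mult.commute power_eq_if)
        then show ?thesis using inv(2)[OF u(1) s] by (simp add: mult_ac)
      qed
      then show ?thesis
        by (intro IH[rule_format, where D = "2 * \<tau> * D", OF V n \<tau> _ L inv(1)[OF u(1)]])
          (use \<tau> D u(2) in \<open>simp_all add: M_def\<close>)
    qed
    then obtain F where F: "\<And>u. u \<in> R \<Longrightarrow> M \<le> wdeg V u {} \<Longrightarrow>
       container_family V u (F u) \<and> card (F u) \<le> (n + 1) ^ (2 * k * L) \<and>
       (\<forall>C\<in>F u. real (card C) + \<delta>' * real n \<le> real (card V))"
      by metis
    have cardB: "\<epsilon> / 4 * real n \<le> real (card (B u))" if u: "u \<in> R" "wdeg V u {} < M" for u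
    proof -
      have "2 ^ k * wdeg V u {} / \<tau> \<le> 2 ^ k * M / \<tau>"
        using u(2) \<tau> by (intro divide_right_mono mult_left_mono) auto
      also have "\<dots> = \<epsilon> / 2 * D * real n" using \<tau> by (simp add: M_def \<epsilon>'_def field_simps)
      finally have "\<epsilon> / 2 * D * real n \<le> wdeg V w {} - 2 ^ k * wdeg V u {} / \<tau>"
        using tot by linarith
      also have "\<dots> \<le> (\<Sum>f | f \<subseteq> V \<and> (\<forall>s\<in>saturated V \<tau> D u. \<not> s \<subseteq> f). w f)"
        by (rule sum_saturated_le[OF V w inv(1)[OF u(1)] \<tau> D]) (use spread in blast)
      also have "\<dots> \<le> (\<Sum>v\<in>V. wdeg V (free_link V \<tau> D w u v) {})"
        by (rule sum_free_link_ge[OF V w])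
      also have "\<dots> \<le> (\<Sum>v\<in>V. a + (if v \<in> B u then D else 0))"
      proof (intro sum_mono)
        fix v assume v: "v \<in> V"
        have "wdeg V (free_link V \<tau> D w u v) {} \<le> wdeg V w {v}"
          using wdeg_free_link_le[OF V w, of \<tau> D u v "{}"] by simp
        also have "\<dots> \<le> D" using spread[rule_format, of "{v}"] v by simp
        finally show "wdeg V (free_link V \<tau> D w u v) {} \<le> a + (if v \<in> B u then D else 0)"
          using v Suc.prems D unfolding B_def a_def by (auto simp: add_increasing)
      qed
      also have "\<dots> = real (card V) * a + real (card (B u)) * D"
      proof -
        have "V \<inter> B u = B u" by (auto simp: B_def)
        then show ?thesis using V by (simp add: sum.distrib sum.If_cases)
      qed
      also have "\<dots> \<le> real n * a + real (card (B u)) * D"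
        using n Suc.prems D by (intro add_right_mono mult_right_mono) (auto simp: a_def)
      finally have "(\<epsilon> / 4 * real n) * D \<le> real (card (B u)) * D" by (simp add: a_def field_simps)
      then show ?thesis using D by simp
    qed
    define R1 where "R1 = {u \<in> R. wdeg V u {} < M}"
    define R2 where "R2 = {u \<in> R. M \<le> wdeg V u {}}"
    define \<C> where "\<C> = (\<lambda>u. V - B u) ` R1 \<union> (\<Union>u\<in>R2. F u)"
    have fin12: "finite R1" "finite R2" using finR by (auto simp: R1_def R2_def)
    have c12: "card R1 \<le> card R" "card R2 \<le> card R"
      using finR by (auto simp: R1_def R2_def intro!: card_mono)
    have fin: "finite \<C>" unfolding \<C>_def using fin12 F by (auto simp: R2_def container_family_def)
    have card: "card \<C> \<le> (n + 1) ^ (2 * Suc k * L)"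
    proof -
      have "card \<C> \<le> card ((\<lambda>u. V - B u) ` R1) + card (\<Union>u\<in>R2. F u)"
        unfolding \<C>_def by (rule card_Un_le)
      also have "card ((\<lambda>u. V - B u) ` R1) \<le> card R"
        using card_image_le[OF fin12(1)] c12(1) by (meson order_trans)
      also have "card (\<Union>u\<in>R2. F u) \<le> (\<Sum>u\<in>R2. card (F u))" by (rule card_UN_le[OF fin12(2)])
      also have "\<dots> \<le> (\<Sum>u\<in>R2. (n + 1) ^ (2 * k * L))" using F by (intro sum_mono) (auto simp: R2_def)
      also have "\<dots> = card R2 * (n + 1) ^ (2 * k * L)" by simp
      also have "\<dots> \<le> card R * (n + 1) ^ (2 * k * L)" using c12(2) by simp
      also have "card R + card R * (n + 1) ^ (2 * k * L) \<le> card R * (2 * (n + 1) ^ (2 * k * L))"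
        by (simp add: algebra_simps)
      \<comment> \<open>One power counts the states and the other absorbs the factor 2, whence the
        exponent \<open>2 * k * L\<close>. The summand 1 in the condition on \<open>L\<close> keeps
        \<open>L\<close> positive.\<close>
      also have "\<dots> \<le> (n + 1) ^ L * ((n + 1) ^ L * (n + 1) ^ (2 * k * L))"
      proof (intro mult_mono cardR)
        have "0 \<le> 2 * \<tau> * real n" using \<tau> by simp
        then have "0 < L" using L by linarith
        then show "2 \<le> (n + 1) ^ L" using n(2) self_le_power[of "n + 1" L] by linarith
      qed auto
      also have "\<dots> = (n + 1) ^ (L + (L + 2 * k * L))" by (simp only: power_add)
      also have "L + (L + 2 * k * L) = 2 * Suc k * L" by simp
      finally show ?thesis by simp
    qed
    have small: "C \<subseteq> V \<and> real (card C) + \<delta> * real n \<le> real (card V)" if C: "C \<in> \<C>" for C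
    proof -
      consider u where "u \<in> R1" "C = V - B u" | u where "u \<in> R2" "C \<in> F u"
        using C unfolding \<C>_def by blast
      then show ?thesis
      proof cases
        case 1
        have BV: "B u \<subseteq> V" by (auto simp: B_def)
        then have "card C + card (B u) = card V"
          using V 1 by (simp add: card_Diff_subset card_mono finite_subset)
        moreover have "\<delta> * real n \<le> \<epsilon> / 4 * real n" by (intro mult_right_mono) (auto simp: \<delta>_def)
        ultimately show ?thesis using cardB[of u] 1 by (auto simp: R1_def)
      next
        case 2
        then have "u \<in> R" "M \<le> wdeg V u {}" by (auto simp: R2_def)
        from F[OF this] 2(2) have "C \<subseteq> V \<and> real (card C) + \<delta>' * real n \<le> real (card V)"
          unfolding container_family_def by blast
        moreover have "\<delta> * real n \<le> \<delta>' * real n" by (intro mult_right_mono) (auto simp: \<delta>_def)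
        ultimately show ?thesis by auto
      qed
    qed
    have cover: "\<exists>C\<in>\<C>. I \<subseteq> C" if I: "I \<subseteq> V" "\<forall>f. f \<subseteq> I \<longrightarrow> w f = 0" for I
    proof -
      have "M \<le> real L * a"
      proof -
        have "\<epsilon>' = \<epsilon> / 4 / 2 ^ k" by (simp add: \<epsilon>'_def)
        also have "\<dots> \<le> \<epsilon> / 4 / 1" using Suc.prems by (intro divide_left_mono) auto
        finally have "\<epsilon>' * (2 * \<tau> * D * real n) \<le> \<epsilon> / 4 * (2 * \<tau> * D * real n)"
          using \<tau> D by (intro mult_right_mono) auto
        then have "M \<le> (2 * \<tau> * real n) * a" by (simp add: M_def a_def mult_ac)
        also have "\<dots> \<le> real L * a" using L Suc.prems D by (intro mult_right_mono) (auto simp: a_def)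
        finally show ?thesis .
      qed
      from link_state_dichotomy[OF V I(1) _ this, of w \<tau> D] I(2) obtain u where
        u: "u \<in> R" and ind: "\<forall>f. f \<subseteq> I \<longrightarrow> u f = 0" and
        alt: "M \<le> wdeg V u {} \<or>
            wdeg V u {} < M \<and> (\<forall>v\<in>I. wdeg V (free_link V \<tau> D w u v) {} < a)"
        unfolding R_def by blast
      from alt show ?thesis
      proof
        assume "M \<le> wdeg V u {}"
        then have "u \<in> R2" and "container_family V u (F u)" using F[OF u] u by (auto simp: R2_def)
        moreover from this(2) obtain C where "C \<in> F u" "I \<subseteq> C"
          using I(1) ind unfolding container_family_def by blast
        ultimately show ?thesis unfolding \<C>_def by blast
      next
        assume "wdeg V u {} < M \<and> (\<forall>v\<in>I. wdeg V (free_link V \<tau> D w u v) {} < a)"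
        then have "I \<subseteq> V - B u" "u \<in> R1" using I u by (auto simp: B_def R1_def)
        then show ?thesis unfolding \<C>_def by blast
      qed
    qed
    have "container_family V w \<C>"
      using fin small cover by (simp add: container_family_def)
    with card small show "\<exists>\<C>. container_family V w \<C> \<and> card \<C> \<le> (n + 1) ^ (2 * Suc k * L) \<and>
       (\<forall>C\<in>\<C>. real (card C) + \<delta> * real n \<le> real (card V))"
      by (intro exI[of _ \<C>] conjI ballI) simp_all
  qed
  show ?case
  proof (intro exI[of _ \<delta>] conjI)
    show "0 < \<delta>" using \<delta>' Suc.prems by (simp add: \<delta>_def)
    show "\<forall>V w \<tau> D n L. ?P (Suc k) \<epsilon> \<delta> V w \<tau> D n L" by (intro allI main)
  qed
qed

lemma wdeg_mono:
  assumes "finite V" "C \<subseteq> V" "uniform_weight V k w"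
  shows "wdeg C w s \<le> wdeg V w s"
  unfolding wdeg_def using assms
  by (intro sum_mono2) (auto simp: finite_supersets uniform_weight_def)

text \<open>Containers of large total weight are refined repeatedly, each time losing
  \<open>\<delta> * n\<close> elements. As \<open>card V \<le> n\<close>, none can survive more than
  \<open>1 / \<delta>\<close> rounds. The bound \<open>n\<close> stays fixed while the vertex set
  shrinks, hence it is kept apart from \<open>card V\<close>. The constant depends on
  \<open>\<epsilon>\<close> and \<open>k\<close> only.\<close>

lemma container:
  fixes \<epsilon> :: real
  assumes \<epsilon>: "0 < \<epsilon>"
  shows "\<exists>K. \<forall>(V :: 'a set) w \<tau> D n L.
    finite V \<longrightarrow> card V \<le> n \<longrightarrow> 1 \<le> n \<longrightarrow> 0 < \<tau> \<longrightarrow> 0 < D \<longrightarrow> 2 * \<tau> * real n + 1 \<le> real L \<longrightarrow>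
    uniform_weight V k w \<longrightarrow>
    (\<forall>s. s \<subseteq> V \<longrightarrow> s \<noteq> {} \<longrightarrow> wdeg V w s \<le> \<tau> ^ (card s - 1) * D) \<longrightarrow>
    (\<exists>\<C>. container_family V w \<C> \<and> card \<C> \<le> (n + 1) ^ (K * L) \<and>
       (\<forall>C\<in>\<C>. wdeg C w {} \<le> \<epsilon> * D * real n))"
proof -
  obtain \<delta> where \<delta>: "0 < \<delta>" and step: "\<forall>(V :: 'a set) w \<tau> D n L.
    finite V \<longrightarrow> card V \<le> n \<longrightarrow> 1 \<le> n \<longrightarrow> 0 < \<tau> \<longrightarrow> 0 < D \<longrightarrow> 2 * \<tau> * real n + 1 \<le> real L \<longrightarrow>
    uniform_weight V k w \<longrightarrow>
    (\<forall>s. s \<subseteq> V \<longrightarrow> s \<noteq> {} \<longrightarrow> wdeg V w s \<le> \<tau> ^ (card s - 1) * D) \<longrightarrow>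
    \<epsilon> * D * real n \<le> wdeg V w {} \<longrightarrow>
    (\<exists>\<C>. container_family V w \<C> \<and> card \<C> \<le> (n + 1) ^ (2 * k * L) \<and>
       (\<forall>C\<in>\<C>. real (card C) + \<delta> * real n \<le> real (card V)))"
    using container_step[OF \<epsilon>, of k] by (elim exE conjE)
  obtain J :: nat where J: "1 < real J * \<delta>" using \<delta> reals_Archimedean3 by blast
  have main: "\<exists>\<C>. container_family V w \<C> \<and> card \<C> \<le> (n + 1) ^ (J * (2 * k) * L) \<and>
       (\<forall>C\<in>\<C>. wdeg C w {} \<le> \<epsilon> * D * real n)"
    if V: "finite V" and n: "card V \<le> n" "1 \<le> n" and \<tau>: "0 < \<tau>" and D: "0 < D"
      and L: "2 * \<tau> * real n + 1 \<le> real L" and w: "uniform_weight V k w"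
      and spread: "\<forall>s. s \<subseteq> V \<longrightarrow> s \<noteq> {} \<longrightarrow> wdeg V w s \<le> \<tau> ^ (card s - 1) * D"
    for V :: "'a set" and w \<tau> D n L
  proof -
    define good where "good C \<longleftrightarrow> wdeg C w {} \<le> \<epsilon> * D * real n" for C
    have refine: "\<exists>\<C>. container_family C w \<C> \<and> card \<C> \<le> (n + 1) ^ (2 * k * L) \<and>
        (\<forall>C'\<in>\<C>. good C' \<or> real (card C') + \<delta> * real n \<le> real (card C))" if C: "C \<subseteq> V" for C
    proof (cases "good C")
      case True
      have "container_family C w {C}" by (auto simp: container_family_def)
      then show ?thesis using True by (intro exI[of _ "{C}"]) auto
    next
      case False
      \<comment> \<open>The weight is cut down to \<open>C\<close> since
        \<open>uniform_weight\<close> wants every edge inside the vertex set. Degrees and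
        independence within \<open>C\<close> are unaffected.\<close>
      define w' where "w' = (\<lambda>f. if f \<subseteq> C then w f else 0)"
      have finC: "finite C" using C V finite_subset by blast
      have cardC: "card C \<le> n" using card_mono[OF V C] n by linarith
      have eq: "wdeg C w' s = wdeg C w s" for s
        unfolding wdeg_def w'_def by (rule sum.cong) auto
      have un: "uniform_weight C k w'" using w by (auto simp: uniform_weight_def w'_def)
      have spread': "wdeg C w' s \<le> \<tau> ^ (card s - 1) * D" if "s \<subseteq> C" "s \<noteq> {}" for s
      proof -
        have "wdeg C w' s \<le> wdeg V w s" using wdeg_mono[OF V C w] by (simp add: eq)
        also have "\<dots> \<le> \<tau> ^ (card s - 1) * D" using spread that C by auto
        finally show ?thesis .
      qed
      have large: "\<epsilon> * D * real n \<le> wdeg C w' {}" using False by (simp add: eq good_def)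
      have "\<exists>\<C>. container_family C w' \<C> \<and> card \<C> \<le> (n + 1) ^ (2 * k * L) \<and>
          (\<forall>C'\<in>\<C>. real (card C') + \<delta> * real n \<le> real (card C))"
        by (rule step[rule_format, OF finC cardC n(2) \<tau> D L un _ large]) (rule spread')
      then obtain \<C> where \<C>: "container_family C w' \<C>" "card \<C> \<le> (n + 1) ^ (2 * k * L)"
        "\<forall>C'\<in>\<C>. real (card C') + \<delta> * real n \<le> real (card C)" by (elim exE conjE)
      have "(\<forall>f. f \<subseteq> I \<longrightarrow> w' f = 0) \<longleftrightarrow> (\<forall>f. f \<subseteq> I \<longrightarrow> w f = 0)" if "I \<subseteq> C" for I
        using that unfolding w'_def by (metis order_trans)
      then have "container_family C w \<C>" using \<C>(1) by (simp add: container_family_def)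
      then show ?thesis using \<C>(2,3) by (intro exI[of _ \<C>] conjI ballI disjI2) simp_all
    qed
    have "\<exists>\<C>. container_family V w \<C> \<and> card \<C> \<le> (n + 1) ^ (j * (2 * k) * L) \<and>
       (\<forall>C\<in>\<C>. good C \<or> real (card C) + real j * \<delta> * real n \<le> real (card V))" for j
    proof (induction j)
      case 0
      have "container_family V w {V}" by (auto simp: container_family_def)
      then show ?case by (intro exI[of _ "{V}"]) auto
    next
      case (Suc j)
      then obtain \<C> where fam: "container_family V w \<C>"
        and card: "card \<C> \<le> (n + 1) ^ (j * (2 * k) * L)"
        and small: "\<forall>C\<in>\<C>. good C \<or> real (card C) + real j * \<delta> * real n \<le> real (card V)"
        by (elim exE conjE)
      have fin: "finite \<C>" and sub: "\<And>C. C \<in> \<C> \<Longrightarrow> C \<subseteq> V"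
        using fam by (auto simp: container_family_def)
      have "\<forall>C\<in>\<C>. \<exists>F. container_family C w F \<and> card F \<le> (n + 1) ^ (2 * k * L) \<and>
          (\<forall>C'\<in>F. good C' \<or> real (card C') + \<delta> * real n \<le> real (card C))"
        by (intro ballI refine sub)
      then obtain F where F': "\<forall>C\<in>\<C>. container_family C w (F C) \<and> card (F C) \<le> (n + 1) ^ (2 * k * L) \<and>
          (\<forall>C'\<in>F C. good C' \<or> real (card C') + \<delta> * real n \<le> real (card C))"
        by (rule bchoice[THEN exE])
      have F: "container_family C w (F C)" "card (F C) \<le> (n + 1) ^ (2 * k * L)"
        "C' \<in> F C \<Longrightarrow> good C' \<or> real (card C') + \<delta> * real n \<le> real (card C)"
        if "C \<in> \<C>" for C C' using F' that by simp_all
      define \<D> where "\<D> = (\<Union>C\<in>\<C>. F C)"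
      have "container_family V w \<D>"
      proof -
        have "finite \<D>" unfolding \<D>_def using fin F(1) by (auto simp: container_family_def)
        moreover have "C' \<subseteq> V" if "C' \<in> \<D>" for C'
        proof -
          obtain C where C: "C \<in> \<C>" "C' \<in> F C" using \<open>C' \<in> \<D>\<close> by (auto simp: \<D>_def)
          then have "C' \<subseteq> C" using F(1)[OF C(1)] by (simp add: container_family_def)
          then show ?thesis using sub[OF C(1)] by (rule order_trans)
        qed
        moreover have "\<exists>C\<in>\<D>. I \<subseteq> C" if I: "I \<subseteq> V" "\<forall>f. f \<subseteq> I \<longrightarrow> w f = 0" for I
        proof -
          have "\<exists>C\<in>\<C>. I \<subseteq> C" using fam I by (simp add: container_family_def)
          then obtain C where C: "C \<in> \<C>" "I \<subseteq> C" by (elim bexE)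
          then have "\<exists>C'\<in>F C. I \<subseteq> C'"
            using F(1)[OF C(1)] I(2) by (simp add: container_family_def)
          then obtain C' where C': "C' \<in> F C" "I \<subseteq> C'" by (elim bexE)
          have "C' \<in> \<D>" unfolding \<D>_def using C(1) C'(1) by (rule UN_I)
          with C'(2) show ?thesis by (rule bexI)
        qed
        ultimately show ?thesis by (simp add: container_family_def)
      qed
      moreover have "card \<D> \<le> (n + 1) ^ (Suc j * (2 * k) * L)"
      proof -
        have "card \<D> \<le> (\<Sum>C\<in>\<C>. card (F C))" unfolding \<D>_def by (rule card_UN_le[OF fin])
        also have "\<dots> \<le> (\<Sum>C\<in>\<C>. (n + 1) ^ (2 * k * L))" using F(2) by (intro sum_mono) auto
        also have "\<dots> = card \<C> * (n + 1) ^ (2 * k * L)" by simp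
        also have "\<dots> \<le> (n + 1) ^ (j * (2 * k) * L) * (n + 1) ^ (2 * k * L)"
          using card by (rule mult_right_mono) simp
        also have "\<dots> = (n + 1) ^ (j * (2 * k) * L + 2 * k * L)" by (simp only: power_add)
        also have "j * (2 * k) * L + 2 * k * L = Suc j * (2 * k) * L" by (simp add: algebra_simps)
        finally show ?thesis .
      qed
      moreover have "good C' \<or> real (card C') + real (Suc j) * \<delta> * real n \<le> real (card V)"
        if C': "C' \<in> \<D>" for C'
      proof -
        obtain C where C: "C \<in> \<C>" "C' \<in> F C" using C' by (auto simp: \<D>_def)
        show ?thesis
        proof (cases "good C")
          case True
          have "C' \<subseteq> C" using F(1)[OF C(1)] C(2) by (simp add: container_family_def)
          moreover have "finite C" using sub[OF C(1)] V by (rule finite_subset)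
          moreover have "uniform_weight C k (\<lambda>f. if f \<subseteq> C then w f else 0)"
            using w by (auto simp: uniform_weight_def)
          moreover have "wdeg C'' (\<lambda>f. if f \<subseteq> C then w f else 0) {} = wdeg C'' w {}"
            if "C'' \<subseteq> C" for C''
            unfolding wdeg_def using that by (intro sum.cong) auto
          ultimately have "wdeg C' w {} \<le> wdeg C w {}"
            using wdeg_mono[of C C' k "\<lambda>f. if f \<subseteq> C then w f else 0" "{}"] by simp
          then show ?thesis using True by (auto simp: good_def)
        next
          case False
          then show ?thesis using small[rule_format, OF C(1)] F(3)[OF C] by (auto simp: algebra_simps)
        qed
      qed
      ultimately show ?case by (intro exI[of _ \<D>] conjI ballI)
    qed
    from this[of J] obtain \<C> where \<C>: "container_family V w \<C>" "card \<C> \<le> (n + 1) ^ (J * (2 * k) * L)"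
       "\<forall>C\<in>\<C>. good C \<or> real (card C) + real J * \<delta> * real n \<le> real (card V)" by (elim exE conjE)
    have "1 * real n < real J * \<delta> * real n" using J n(2) by (intro mult_strict_right_mono) auto
    then have "good C" if "C \<in> \<C>" for C using \<C>(3)[rule_format, OF that] n(1) by auto
    then show ?thesis using \<C>(1,2) unfolding good_def by (intro exI[of _ \<C>] conjI ballI)
  qed
  show ?thesis by (rule exI[of _ "J * (2 * k)"], intro allI impI, rule main) simp_all
qed

subsection \<open>Copies of graphs in the complete graph\<close>

definition embeddings :: "nat \<Rightarrow> nat \<Rightarrow> (nat \<Rightarrow> nat) set" where
  "embeddings n N = {\<phi> \<in> {..<n} \<rightarrow>\<^sub>E {..<N}. inj_on \<phi> {..<n}}"

lemma finite_embeddings: "finite (embeddings n N)"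
  unfolding embeddings_def by (rule finite_subset[OF _ finite_PiE[of "{..<n}" "\<lambda>_. {..<N}"]]) auto

lemma card_embeddings_le: "card (embeddings n N) \<le> N ^ n"
proof -
  have "card (embeddings n N) \<le> card ({..<n} \<rightarrow>\<^sub>E {..<N})"
    unfolding embeddings_def by (intro card_mono finite_PiE) auto
  then show ?thesis by (simp add: card_funcsetE)
qed

lemma card_extensions_le:
  assumes "finite I" "finite B" "A \<subseteq> I"
  shows "card {\<psi> \<in> I \<rightarrow>\<^sub>E B. \<forall>i\<in>A. \<psi> i = h i} \<le> card B ^ (card I - card A)"
proof -
  let ?X = "{\<psi> \<in> I \<rightarrow>\<^sub>E B. \<forall>i\<in>A. \<psi> i = h i}"
  have "inj_on (\<lambda>\<psi>. restrict \<psi> (I - A)) ?X"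
  proof (rule inj_onI)
    fix \<psi> \<chi> assume X: "\<psi> \<in> ?X" "\<chi> \<in> ?X" and eq: "restrict \<psi> (I - A) = restrict \<chi> (I - A)"
    have "\<psi> i = \<chi> i" if "i \<in> I" for i
    proof (cases "i \<in> A")
      case False
      then show ?thesis using fun_cong[OF eq, of i] that by simp
    qed (use X in auto)
    then show "\<psi> = \<chi>" using X by (intro PiE_ext[of \<psi> I "\<lambda>_. B" \<chi>]) auto
  qed
  moreover have "(\<lambda>\<psi>. restrict \<psi> (I - A)) ` ?X \<subseteq> (I - A) \<rightarrow>\<^sub>E B" by auto
  ultimately have "card ?X \<le> card ((I - A) \<rightarrow>\<^sub>E B)"
    using assms by (intro card_inj_on_le finite_PiE) auto
  then show ?thesis using assms by (simp add: card_funcsetE card_Diff_subset finite_subset)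
qed

text \<open>Guessing a preimage for every point of \<open>U\<close> costs \<open>n ^ card U\<close>,
  and a correct guess fixes \<open>\<phi>\<close> at \<open>card U\<close> positions.\<close>

lemma card_embeddings_onto_le:
  assumes U: "finite U"
  shows "card {\<phi> \<in> embeddings n N. U \<subseteq> \<phi> ` {..<n}} \<le> n ^ card U * N ^ (n - card U)"
proof -
  let ?X = "\<lambda>g. {\<phi> \<in> embeddings n N. \<forall>x\<in>U. \<phi> (g x) = x}"
  have fin: "finite (U \<rightarrow>\<^sub>E {..<n})" using U by (intro finite_PiE) auto
  have "{\<phi> \<in> embeddings n N. U \<subseteq> \<phi> ` {..<n}} \<subseteq> (\<Union>g\<in>U \<rightarrow>\<^sub>E {..<n}. ?X g)"
  proof
    fix \<phi> assume \<phi>: "\<phi> \<in> {\<phi> \<in> embeddings n N. U \<subseteq> \<phi> ` {..<n}}"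
    then have "\<forall>x\<in>U. \<exists>i<n. \<phi> i = x" by auto
    then obtain g where g: "\<And>x. x \<in> U \<Longrightarrow> g x < n \<and> \<phi> (g x) = x" by metis
    then have "restrict g U \<in> U \<rightarrow>\<^sub>E {..<n}" "\<phi> \<in> ?X (restrict g U)" using \<phi> by auto
    then show "\<phi> \<in> (\<Union>g\<in>U \<rightarrow>\<^sub>E {..<n}. ?X g)" by blast
  qed
  then have "card {\<phi> \<in> embeddings n N. U \<subseteq> \<phi> ` {..<n}} \<le> card (\<Union>g\<in>U \<rightarrow>\<^sub>E {..<n}. ?X g)"
    using fin finite_embeddings by (intro card_mono) auto
  also have "\<dots> \<le> (\<Sum>g\<in>U \<rightarrow>\<^sub>E {..<n}. card (?X g))" by (rule card_UN_le[OF fin])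
  also have "\<dots> \<le> (\<Sum>g\<in>U \<rightarrow>\<^sub>E {..<n}. N ^ (n - card U))"
  proof (rule sum_mono)
    fix g assume g: "g \<in> U \<rightarrow>\<^sub>E {..<n}"
    show "card (?X g) \<le> N ^ (n - card U)"
    proof (cases "?X g = {}")
      case False
      then obtain \<phi> where \<phi>: "\<And>x. x \<in> U \<Longrightarrow> \<phi> (g x) = x" by blast
      \<comment> \<open>A guess realised by some \<open>\<phi>\<close> has a left inverse, so it
        fixes as many positions as \<open>U\<close> has points.\<close>
      have inj: "inj_on g U" using \<phi> by (metis inj_onI)
      have "?X g \<subseteq> {\<psi> \<in> {..<n} \<rightarrow>\<^sub>E {..<N}. \<forall>i\<in>g ` U. \<psi> i = inv_into U g i}"
        using inj by (auto simp: embeddings_def inv_into_f_f)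
      then have "card (?X g) \<le> card {\<psi> \<in> {..<n} \<rightarrow>\<^sub>E {..<N}. \<forall>i\<in>g ` U. \<psi> i = inv_into U g i}"
        by (intro card_mono) (auto intro!: finite_subset[OF _ finite_PiE[of "{..<n}" "\<lambda>_. {..<N}"]])
      also have "\<dots> \<le> card {..<N} ^ (card {..<n} - card (g ` U))"
        using g by (intro card_extensions_le) auto
      finally show ?thesis using inj by (simp add: card_image)
    next
      case True
      then show ?thesis by (simp only: card.empty)
    qed
  qed
  also have "\<dots> = n ^ card U * N ^ (n - card U)" using U by (simp add: card_funcsetE)
  finally show ?thesis .
qed

text \<open>The handshake bound \<open>2 * card s \<le> \<Delta> * card (\<Union>s)\<close> suffices
  from four vertices on. For two and three vertices the number of all pairs is used: a single edge
  gives equality, and the triangle requires \<open>\<Delta> \<ge> 2\<close>. The additive form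
  avoids truncated subtraction.\<close>

lemma card_edges_le:
  assumes fin: "finite s" and two: "\<And>e. e \<in> s \<Longrightarrow> card e = 2"
    and deg: "\<And>x. card {e \<in> s. x \<in> e} \<le> \<Delta>" and \<Delta>: "2 \<le> \<Delta>" and ne: "s \<noteq> {}"
  shows "card s + 2 * \<Delta> \<le> 1 + \<Delta> * card (\<Union>s)"
proof -
  let ?U = "\<Union>s"
  have fe: "finite e" if "e \<in> s" for e using two[OF that] card.infinite by fastforce
  have finU: "finite ?U" using fin fe by auto
  have "2 * card s = (\<Sum>e\<in>s. card e)" using two by simp
  also have "\<dots> = (\<Sum>e\<in>s. \<Sum>x\<in>?U. if x \<in> e then 1 else 0)"
  proof (rule sum.cong[OF refl])
    fix e assume "e \<in> s"
    then have "{x \<in> ?U. x \<in> e} = e" by auto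
    then show "card e = (\<Sum>x\<in>?U. if x \<in> e then 1 else 0)"
      using finU by (simp add: sum.inter_filter[symmetric])
  qed
  also have "\<dots> = (\<Sum>x\<in>?U. \<Sum>e\<in>s. if x \<in> e then 1 else 0)" by (rule sum.swap)
  also have "\<dots> = (\<Sum>x\<in>?U. card {e \<in> s. x \<in> e})"
    using fin by (simp add: sum.inter_filter[symmetric])
  also have "\<dots> \<le> (\<Sum>x\<in>?U. \<Delta>)" using deg by (intro sum_mono)
  finally have double: "2 * card s \<le> card ?U * \<Delta>" by simp
  have "s \<subseteq> nsets ?U 2" using two fe by (auto simp: nsets_def)
  then have choose: "card s \<le> card ?U choose 2"
    using card_mono[of "nsets ?U 2" s] finU by (simp add: finite_imp_finite_nsets)
  obtain e where "e \<in> s" using ne by auto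
  then have U2: "2 \<le> card ?U" using two[of e] card_mono[of ?U e] finU by auto
  consider "card ?U = 2" | "card ?U = 3" | "4 \<le> card ?U" using U2 by linarith
  then show ?thesis
  proof cases
    case 1
    then show ?thesis using choose by simp
  next
    case 2
    then have "card s \<le> 3" using choose by (simp add: choose_two)
    then show ?thesis using 2 \<Delta> by simp
  next
    case 3
    then have "4 * \<Delta> \<le> card ?U * \<Delta>" by (rule mult_le_mono1)
    then have "card s + 2 * \<Delta> \<le> card ?U * \<Delta>" using double by linarith
    then show ?thesis by (simp add: mult.commute)
  qed
qed

section \<open>Ramsey supersaturation\<close>

text \<open>Let \<open>M\<close> be a Ramsey number for \<open>r\<close> colours and cliques of size
  \<open>n\<close>, and consider all \<open>N ^ M\<close> maps from \<open>{..<M}\<close> to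
  \<open>{..<N}\<close>. A map sends two points to the same point, or a pair to an uncovered pair,
  or else Ramsey's theorem finds a clique whose image lies in one \<open>C i\<close>. If cliques in
  the \<open>C i\<close> and uncovered pairs were both rare, these cases could not account for all
  maps.\<close>

lemma clique_supersaturation:
  fixes r n :: nat
  shows "\<exists>\<epsilon>>0. \<exists>N0. \<forall>N\<ge>N0. \<forall>C.
     (\<forall>i<r. real (card {\<phi> \<in> embeddings n N. (`) \<phi> ` [{..<n}]\<^bsup>2\<^esup> \<subseteq> C i}) \<le> \<epsilon> * real N ^ n) \<longrightarrow>
     \<epsilon> * (real N)\<^sup>2 \<le> real (card ([{..<N}]\<^bsup>2\<^esup> - (\<Union>i<r. C i)))"
proof -
  obtain M0 :: nat where "partn_lst {..<M0} (replicate r n) 2"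
    using ramsey_full[of "replicate r n" 2] by (elim exE)
  \<comment> \<open>The shift by 2 guarantees two coordinates, so that \<open>N ^ M\<close> has the
    factor \<open>N\<^sup>2\<close>.\<close>
  define M where "M = M0 + 2"
  have ram: "partn_lst {..<M} (replicate r n) 2"
    using partn_lst_greater_resource[OF \<open>partn_lst {..<M0} (replicate r n) 2\<close>] by (simp add: M_def)
  have M2: "2 \<le> M" by (simp add: M_def)
  \<comment> \<open>\<open>B\<close> collects the coefficients of \<open>\<epsilon>\<close> in the
    final count, and \<open>\<epsilon> * B \<le> 1 / 4\<close>. Collisions take another quarter once
    \<open>4 * M\<^sup>2 \<le> N\<close>, so only half of the maps are accounted for.\<close>
  define B where "B = 2 * real M ^ 2 + real r * real M ^ n"
  define \<epsilon> where "\<epsilon> = 1 / (4 * (B + 1))"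
  have B0: "0 \<le> B" by (simp add: B_def)
  then have \<epsilon>: "0 < \<epsilon>" by (simp add: \<epsilon>_def)
  have "\<epsilon> * (real N)\<^sup>2 \<le> real (card ([{..<N}]\<^bsup>2\<^esup> - (\<Union>i<r. C i)))"
    if N: "4 * M\<^sup>2 \<le> N" and
      few: "\<And>i. i < r \<Longrightarrow>
        real (card {\<phi> \<in> embeddings n N. (`) \<phi> ` [{..<n}]\<^bsup>2\<^esup> \<subseteq> C i}) \<le> \<epsilon> * real N ^ n" for N C
  proof (rule ccontr)
    let ?D = "[{..<N}]\<^bsup>2\<^esup> - (\<Union>i<r. C i)"
    let ?Q = "\<lambda>i. {\<phi> \<in> embeddings n N. (`) \<phi> ` [{..<n}]\<^bsup>2\<^esup> \<subseteq> C i}"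
    let ?\<Psi> = "{..<M} \<rightarrow>\<^sub>E {..<N}"
    assume "\<not> \<epsilon> * (real N)\<^sup>2 \<le> real (card ?D)"
    then have D: "real (card ?D) < \<epsilon> * (real N)\<^sup>2" by simp
    have N0: "0 < N" using N M2 by (metis gr0I le_zero_eq mult_eq_0_iff not_numeral_le_zero power_eq_0_iff zero_neq_numeral)
    define P where "P = {(a, b). a < N \<and> b < N \<and> (a = b \<or> {a, b} \<in> ?D)}"
    define T where "T = {(i, j). i < M \<and> j < M \<and> i \<noteq> j}"
    have finP: "finite P" by (rule finite_subset[of _ "{..<N} \<times> {..<N}"]) (auto simp: P_def)
    have finT: "finite T" by (rule finite_subset[of _ "{..<M} \<times> {..<M}"]) (auto simp: T_def)
    have cT: "card T \<le> M\<^sup>2"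
      using card_mono[of "{..<M} \<times> {..<M}" T] by (auto simp: T_def power2_eq_square)
    have finD: "finite ?D" by (simp add: finite_imp_finite_nsets)
    have cP: "card P \<le> N + 2 * card ?D"
    proof -
      have "P \<subseteq> (\<lambda>a. (a, a)) ` {..<N} \<union> ((\<lambda>e. (Min e, Max e)) ` ?D \<union> (\<lambda>e. (Max e, Min e)) ` ?D)"
      proof
        fix x assume "x \<in> P"
        then obtain a b where x: "x = (a, b)" "a < N" "a = b \<or> {a, b} \<in> ?D" by (auto simp: P_def)
        then consider "a = b" | "{a, b} \<in> ?D" "a \<le> b" | "{a, b} \<in> ?D" "b \<le> a" by linarith
        then show "x \<in> (\<lambda>a. (a, a)) ` {..<N} \<union> ((\<lambda>e. (Min e, Max e)) ` ?D \<union> (\<lambda>e. (Max e, Min e)) ` ?D)"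
        proof cases
          case 2
          then have "x = (Min {a, b}, Max {a, b})" using x by simp
          then show ?thesis using 2 by blast
        next
          case 3
          then have "x = (Max {a, b}, Min {a, b})" using x by simp
          then show ?thesis using 3 by blast
        qed (use x in auto)
      qed
      then have "card P \<le> card ((\<lambda>a. (a, a)) ` {..<N} \<union> ((\<lambda>e. (Min e, Max e)) ` ?D \<union> (\<lambda>e. (Max e, Min e)) ` ?D))"
        using finD by (intro card_mono) auto
      also have "\<dots> \<le> card ((\<lambda>a. (a, a)) ` {..<N}) + (card ((\<lambda>e. (Min e, Max e)) ` ?D) + card ((\<lambda>e. (Max e, Min e)) ` ?D))"
        by (meson card_Un_le add_left_mono order_trans)
      also have "\<dots> \<le> card {..<N} + (card ?D + card ?D)"
        using finD by (intro add_mono card_image_le) auto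
      finally show ?thesis by simp
    qed
    let ?X = "\<lambda>(i, j) (a, b). {\<psi> \<in> ?\<Psi>. \<psi> i = a \<and> \<psi> j = b}"
    let ?Y = "\<lambda>\<chi> \<phi>. {\<psi> \<in> ?\<Psi>. \<forall>k<n. \<psi> (\<chi> k) = \<phi> k}"
    have fin\<Psi>: "finite ?\<Psi>" by (intro finite_PiE) auto
    have cover: "?\<Psi> \<subseteq> (\<Union>t\<in>T. \<Union>q\<in>P. ?X t q) \<union> (\<Union>i<r. \<Union>\<chi>\<in>embeddings n M. \<Union>\<phi>\<in>?Q i. ?Y \<chi> \<phi>)"
    proof
      fix \<psi> assume \<psi>: "\<psi> \<in> ?\<Psi>"
      show "\<psi> \<in> (\<Union>t\<in>T. \<Union>q\<in>P. ?X t q) \<union> (\<Union>i<r. \<Union>\<chi>\<in>embeddings n M. \<Union>\<phi>\<in>?Q i. ?Y \<chi> \<phi>)"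
      proof (cases "\<exists>(i, j)\<in>T. (\<psi> i, \<psi> j) \<in> P")
        case True
        then obtain i j where "(i, j) \<in> T" "(\<psi> i, \<psi> j) \<in> P" by blast
        moreover have "\<psi> \<in> ?X (i, j) (\<psi> i, \<psi> j)" using \<psi> by simp
        ultimately show ?thesis by (intro UnI1 UN_I)
      next
        case False
        have ok: "\<psi> i \<noteq> \<psi> j \<and> (\<exists>k<r. {\<psi> i, \<psi> j} \<in> C k)" if "i < M" "j < M" "i \<noteq> j" for i j
        proof -
          have lt: "\<psi> i < N" "\<psi> j < N" using \<psi> that by (auto simp: PiE_iff)
          have "(\<psi> i, \<psi> j) \<notin> P" using False that by (auto simp: T_def)
          then have "\<psi> i \<noteq> \<psi> j" "{\<psi> i, \<psi> j} \<notin> ?D" using lt by (auto simp: P_def)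
          then show ?thesis using lt by auto
        qed
        \<comment> \<open>Colouring a pair of \<open>{..<M}\<close> by the index of a
          \<open>C k\<close> containing its image turns the covering into a colouring for Ramsey's
          theorem.\<close>
        define f where "f e = (SOME k. k < r \<and> \<psi> ` e \<in> C k)" for e
        have f: "f e < r \<and> \<psi> ` e \<in> C (f e)" if e: "e \<in> [{..<M}]\<^bsup>2\<^esup>" for e
        proof -
          obtain i j where "e = {i, j}" "i < M" "j < M" "i \<noteq> j" using e by (auto elim!: nsets2_E)
          then have "\<exists>k. k < r \<and> \<psi> ` e \<in> C k" using ok[of i j] by auto
          then show ?thesis unfolding f_def by (rule someI_ex)
        qed
        then have "f \<in> [{..<M}]\<^bsup>2\<^esup> \<rightarrow> {..<r}" by auto
        from partn_lstE[OF ram this] obtain k H where k: "k < r"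
          and H: "H \<in> [{..<M}]\<^bsup>n\<^esup>" and mono: "f ` [H]\<^bsup>2\<^esup> \<subseteq> {k}"
          by (metis length_replicate nth_replicate)
        have Hf: "finite H" "card H = n" "H \<subseteq> {..<M}" using H by (auto simp: nsets_def)
        then obtain \<chi>0 where "bij_betw \<chi>0 {..<n} H"
          by (metis atLeast0LessThan ex_bij_betw_nat_finite)
        then have \<chi>: "bij_betw (restrict \<chi>0 {..<n}) {..<n} H" by (subst bij_betw_cong[of _ _ \<chi>0]) auto
        define \<chi> where "\<chi> = restrict \<chi>0 {..<n}"
        have \<chi>H: "\<chi> ` {..<n} = H" and \<chi>i: "inj_on \<chi> {..<n}"
          using \<chi> by (auto simp: \<chi>_def bij_betw_def)
        have \<chi>E: "\<chi> \<in> embeddings n M"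
          using \<chi>H \<chi>i Hf by (auto simp: embeddings_def \<chi>_def PiE_iff)
        define \<phi> where "\<phi> = restrict (\<psi> \<circ> \<chi>) {..<n}"
        have \<psi>i: "inj_on \<psi> {..<M}" using ok by (meson inj_onI lessThan_iff)
        have lt: "\<chi> k < M" if "k < n" for k using \<chi>E that by (auto simp: embeddings_def)
        have "inj_on (\<psi> \<circ> \<chi>) {..<n}"
          using \<psi>i \<chi>i lt by (intro comp_inj_on) (auto intro: inj_on_subset)
        then have "inj_on \<phi> {..<n}" by (auto simp: \<phi>_def inj_on_def)
        moreover have "\<phi> \<in> {..<n} \<rightarrow>\<^sub>E {..<N}"
          using \<psi> lt unfolding \<phi>_def by (auto simp: PiE_iff)
        ultimately have \<phi>E: "\<phi> \<in> embeddings n N" by (simp add: embeddings_def)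
        have "(`) \<phi> ` [{..<n}]\<^bsup>2\<^esup> \<subseteq> C k"
        proof
          fix e assume "e \<in> (`) \<phi> ` [{..<n}]\<^bsup>2\<^esup>"
          then obtain i j where e: "e = {\<phi> i, \<phi> j}" and ij: "i < n" "j < n" "i \<noteq> j"
            by (auto elim!: nsets2_E)
          have "{\<chi> i, \<chi> j} \<in> [H]\<^bsup>2\<^esup>" using ij \<chi>H \<chi>i by (auto simp: inj_on_def)
          then have "f {\<chi> i, \<chi> j} = k" "{\<chi> i, \<chi> j} \<in> [{..<M}]\<^bsup>2\<^esup>"
            using mono nsets_mono[OF Hf(3)] by blast+
          then show "e \<in> C k" using f[of "{\<chi> i, \<chi> j}"] ij by (simp add: e \<phi>_def)
        qed
        then have "\<phi> \<in> ?Q k" using \<phi>E by simp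
        moreover have "\<psi> \<in> ?Y \<chi> \<phi>" using \<psi> by (simp add: \<phi>_def)
        moreover have "k \<in> {..<r}" using k by simp
        ultimately show ?thesis using \<chi>E by (intro UnI2 UN_I)
      qed
    qed
    have cX: "card (?X t q) \<le> N ^ (M - 2)" if t: "t \<in> T" and q: "q \<in> P" for t q
    proof -
      obtain i j a b where tq: "t = (i, j)" "q = (a, b)" by (cases t, cases q) auto
      have ij: "i < M" "j < M" "i \<noteq> j" using t tq by (auto simp: T_def)
      have "?X t q = {\<psi> \<in> ?\<Psi>. \<forall>k\<in>{i, j}. \<psi> k = (if k = i then a else b)}"
        using ij tq by auto
      then show ?thesis
        using card_extensions_le[of "{..<M}" "{..<N}" "{i, j}" "\<lambda>k. if k = i then a else b"] ij
        by (simp add: numeral_2_eq_2)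
    qed
    have cY: "card (?Y \<chi> \<phi>) \<le> N ^ (M - n)" and nM: "n \<le> M" if \<chi>: "\<chi> \<in> embeddings n M" for \<chi> \<phi>
    proof -
      have inj: "inj_on \<chi> {..<n}" and sub: "\<chi> ` {..<n} \<subseteq> {..<M}"
        using \<chi> by (auto simp: embeddings_def)
      have "?Y \<chi> \<phi> = {\<psi> \<in> ?\<Psi>. \<forall>k\<in>\<chi> ` {..<n}. \<psi> k = \<phi> (inv_into {..<n} \<chi> k)}"
        using inj by (auto simp: inv_into_f_f)
      then show "card (?Y \<chi> \<phi>) \<le> N ^ (M - n)"
        using card_extensions_le[of "{..<M}" "{..<N}" "\<chi> ` {..<n}" "\<lambda>k. \<phi> (inv_into {..<n} \<chi> k)"]
          inj sub by (simp add: card_image)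
      show "n \<le> M" using inj sub card_inj_on_le[of \<chi> "{..<n}" "{..<M}"] by simp
    qed
    have "real (card (\<Union>t\<in>T. \<Union>q\<in>P. ?X t q)) \<le> real M ^ 2 * (real N + 2 * real (card ?D)) * real N ^ (M - 2)"
    proof -
      have "card (\<Union>t\<in>T. \<Union>q\<in>P. ?X t q) \<le> (\<Sum>t\<in>T. card (\<Union>q\<in>P. ?X t q))"
        by (rule card_UN_le[OF finT])
      also have "\<dots> \<le> (\<Sum>t\<in>T. \<Sum>q\<in>P. card (?X t q))"
        by (intro sum_mono card_UN_le[OF finP])
      also have "\<dots> \<le> (\<Sum>t\<in>T. \<Sum>q\<in>P. N ^ (M - 2))"
        by (intro sum_mono cX)
      also have "\<dots> = card T * card P * N ^ (M - 2)" by simp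
      also have "\<dots> \<le> M\<^sup>2 * (N + 2 * card ?D) * N ^ (M - 2)"
        using cT cP by (intro mult_mono) auto
      finally have "real (card (\<Union>t\<in>T. \<Union>q\<in>P. ?X t q)) \<le> real (M\<^sup>2 * (N + 2 * card ?D) * N ^ (M - 2))"
        by (rule of_nat_mono)
      then show ?thesis by simp
    qed
    moreover have "real (card (\<Union>i<r. \<Union>\<chi>\<in>embeddings n M. \<Union>\<phi>\<in>?Q i. ?Y \<chi> \<phi>))
        \<le> real r * (real M ^ n * (\<epsilon> * real N ^ M))"
    proof -
      have finQ: "finite (?Q i)" for i using finite_embeddings by simp
      have "card (\<Union>i<r. \<Union>\<chi>\<in>embeddings n M. \<Union>\<phi>\<in>?Q i. ?Y \<chi> \<phi>)
          \<le> (\<Sum>i<r. card (\<Union>\<chi>\<in>embeddings n M. \<Union>\<phi>\<in>?Q i. ?Y \<chi> \<phi>))"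
        by (rule card_UN_le) simp
      also have "\<dots> \<le> (\<Sum>i<r. \<Sum>\<chi>\<in>embeddings n M. card (\<Union>\<phi>\<in>?Q i. ?Y \<chi> \<phi>))"
        by (intro sum_mono card_UN_le finite_embeddings)
      also have "\<dots> \<le> (\<Sum>i<r. \<Sum>\<chi>\<in>embeddings n M. \<Sum>\<phi>\<in>?Q i. card (?Y \<chi> \<phi>))"
        by (intro sum_mono card_UN_le finQ)
      also have "\<dots> \<le> (\<Sum>i<r. \<Sum>\<chi>\<in>embeddings n M. \<Sum>\<phi>\<in>?Q i. N ^ (M - n))"
        by (intro sum_mono cY)
      finally have "real (card (\<Union>i<r. \<Union>\<chi>\<in>embeddings n M. \<Union>\<phi>\<in>?Q i. ?Y \<chi> \<phi>))
          \<le> real (\<Sum>i<r. \<Sum>\<chi>\<in>embeddings n M. \<Sum>\<phi>\<in>?Q i. N ^ (M - n))"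
        by (rule of_nat_mono)
      also have "\<dots> = (\<Sum>i<r. \<Sum>\<chi>\<in>embeddings n M. real (card (?Q i)) * real N ^ (M - n))"
        by simp
      also have "\<dots> \<le> (\<Sum>i<r. \<Sum>\<chi>\<in>embeddings n M. \<epsilon> * real N ^ M)"
      proof (intro sum_mono)
        fix i \<chi> assume i: "i \<in> {..<r}" and \<chi>: "\<chi> \<in> embeddings n M"
        have "real (card (?Q i)) * real N ^ (M - n) \<le> (\<epsilon> * real N ^ n) * real N ^ (M - n)"
          using few i by (intro mult_right_mono) auto
        also have "\<dots> = \<epsilon> * real N ^ M"
          using nM[OF \<chi>] by (simp add: mult.assoc flip: power_add)
        finally show "real (card (?Q i)) * real N ^ (M - n) \<le> \<epsilon> * real N ^ M" .
      qed
      also have "\<dots> = real r * (real (card (embeddings n M)) * (\<epsilon> * real N ^ M))" by simp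
      also have "\<dots> \<le> real r * (real M ^ n * (\<epsilon> * real N ^ M))"
        using card_embeddings_le[of n M] \<epsilon>
        by (intro mult_left_mono mult_right_mono) (simp_all flip: of_nat_power)
      finally show ?thesis .
    qed
    moreover have "real N ^ M \<le> real (card (\<Union>t\<in>T. \<Union>q\<in>P. ?X t q))
        + real (card (\<Union>i<r. \<Union>\<chi>\<in>embeddings n M. \<Union>\<phi>\<in>?Q i. ?Y \<chi> \<phi>))"
    proof -
      let ?A = "\<Union>t\<in>T. \<Union>q\<in>P. ?X t q" and ?B = "\<Union>i<r. \<Union>\<chi>\<in>embeddings n M. \<Union>\<phi>\<in>?Q i. ?Y \<chi> \<phi>"
      have "?A \<union> ?B \<subseteq> ?\<Psi>" by auto
      then have "finite (?A \<union> ?B)" using fin\<Psi> by (rule finite_subset)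
      then have "card ?\<Psi> \<le> card (?A \<union> ?B)" using cover by (rule card_mono)
      also have "\<dots> \<le> card ?A + card ?B" by (rule card_Un_le)
      finally have "N ^ M \<le> card ?A + card ?B" by (simp add: card_funcsetE)
      then have "real (N ^ M) \<le> real (card ?A + card ?B)" by (rule of_nat_mono)
      then show ?thesis by (simp only: of_nat_add of_nat_power)
    qed
    ultimately have main: "real N ^ M \<le> real M ^ 2 * (real N + 2 * real (card ?D)) * real N ^ (M - 2)
        + real r * (real M ^ n * (\<epsilon> * real N ^ M))" by linarith
    have NM: "real N ^ M = (real N)\<^sup>2 * real N ^ (M - 2)"
      using M2 by (metis le_add_diff_inverse power_add)
    have "real M ^ 2 * (real N + 2 * real (card ?D)) * real N ^ (M - 2)
        \<le> real M ^ 2 * (real N + 2 * (\<epsilon> * (real N)\<^sup>2)) * real N ^ (M - 2)"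
      using D by (intro mult_right_mono mult_left_mono) auto
    also have "real M ^ 2 * (real N + 2 * (\<epsilon> * (real N)\<^sup>2)) \<le> (1 / 4 + 2 * \<epsilon> * real M ^ 2) * (real N)\<^sup>2"
    proof -
      have "4 * real M ^ 2 \<le> real N" using N by (metis of_nat_mono of_nat_mult of_nat_numeral of_nat_power)
      then have "4 * real M ^ 2 * real N \<le> real N * real N" by (intro mult_right_mono) auto
      then show ?thesis by (simp add: algebra_simps power2_eq_square)
    qed
    then have "real M ^ 2 * (real N + 2 * (\<epsilon> * (real N)\<^sup>2)) * real N ^ (M - 2)
        \<le> (1 / 4 + 2 * \<epsilon> * real M ^ 2) * (real N)\<^sup>2 * real N ^ (M - 2)"
      by (rule mult_right_mono) simp
    finally have "real N ^ M \<le> (1 / 4 + 2 * \<epsilon> * real M ^ 2) * real N ^ M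
        + real r * (real M ^ n * (\<epsilon> * real N ^ M))"
      using main by (simp add: NM mult.assoc)
    also have "\<dots> = (1 / 4 + \<epsilon> * B) * real N ^ M" by (simp add: B_def algebra_simps)
    finally have "1 * real N ^ M \<le> (1 / 4 + \<epsilon> * B) * real N ^ M" by simp
    then have "1 \<le> 1 / 4 + \<epsilon> * B" using N0 by (subst (asm) mult_le_cancel_right_pos) auto
    moreover have "\<epsilon> * B \<le> 1 / 4" using B0 by (simp add: \<epsilon>_def field_simps)
    ultimately show False by simp
  qed
  then show ?thesis using \<epsilon> by blast
qed

section \<open>The hypergraph of copies of a fixed graph\<close>

lemma sum_card_fibres:
  assumes "finite A" "finite F"
  shows "(\<Sum>f\<in>F. real (card {x \<in> A. g x = f})) = real (card {x \<in> A. g x \<in> F})"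
proof -
  have "(\<Sum>f\<in>F. real (card {x \<in> A. g x = f})) = (\<Sum>f\<in>F. \<Sum>x\<in>A. if g x = f then 1 else 0)"
    using assms by (simp add: sum.inter_filter[symmetric])
  also have "\<dots> = (\<Sum>x\<in>A. \<Sum>f\<in>F. if g x = f then 1 else 0)" by (rule sum.swap)
  also have "\<dots> = (\<Sum>x\<in>A. if g x \<in> F then 1 else 0)" using assms by (simp add: sum.delta)
  also have "\<dots> = real (card {x \<in> A. g x \<in> F})"
    using assms by (simp add: sum.inter_filter[symmetric])
  finally show ?thesis .
qed

text \<open>Counting embeddings rather than image sets avoids automorphism factors, and it places
  the isolated vertices too. Totals for different edge sets are then all compared with
  \<open>N ^ n\<close>.\<close>

definition copy_weight :: "nat \<Rightarrow> nat \<Rightarrow> nat set set \<Rightarrow> nat set set \<Rightarrow> real" where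
  "copy_weight n N E f = real (card {\<phi> \<in> embeddings n N. (`) \<phi> ` E = f})"

lemma wdeg_copy_weight:
  assumes "finite C"
  shows "wdeg C (copy_weight n N E) s =
    real (card {\<phi> \<in> embeddings n N. s \<subseteq> (`) \<phi> ` E \<and> (`) \<phi> ` E \<subseteq> C})"
proof -
  have "wdeg C (copy_weight n N E) s
      = real (card {\<phi> \<in> embeddings n N. (`) \<phi> ` E \<in> {f. f \<subseteq> C \<and> s \<subseteq> f}})"
    unfolding wdeg_def copy_weight_def
    by (rule sum_card_fibres[OF finite_embeddings finite_supersets[OF assms]])
  also have "{\<phi> \<in> embeddings n N. (`) \<phi> ` E \<in> {f. f \<subseteq> C \<and> s \<subseteq> f}}
      = {\<phi> \<in> embeddings n N. s \<subseteq> (`) \<phi> ` E \<and> (`) \<phi> ` E \<subseteq> C}" by auto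
  finally show ?thesis .
qed

lemma copy_subset_pairs:
  assumes \<phi>: "\<phi> \<in> embeddings n N" and E: "E \<subseteq> [{..<n}]\<^bsup>2\<^esup>"
  shows "(`) \<phi> ` E \<subseteq> [{..<N}]\<^bsup>2\<^esup>"
proof -
  have "\<phi> \<in> {..<n} \<rightarrow> {..<N}" "inj_on \<phi> {..<n}" using \<phi> by (auto simp: embeddings_def)
  then have "(`) \<phi> ` [{..<n}]\<^bsup>2\<^esup> \<subseteq> [{..<N}]\<^bsup>2\<^esup>"
    by (auto simp: nsets_def card_image inj_on_subset)
  then show ?thesis using E by blast
qed

lemma inj_on_image_edges:
  assumes \<phi>: "\<phi> \<in> embeddings n N" and E: "E \<subseteq> [{..<n}]\<^bsup>2\<^esup>"
  shows "inj_on ((`) \<phi>) E"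
proof -
  have "inj_on ((`) \<phi>) (Pow {..<n})" using \<phi> by (simp add: embeddings_def inj_on_image_Pow)
  moreover have "E \<subseteq> Pow {..<n}" using E by (auto simp: nsets_def)
  ultimately show ?thesis by (rule inj_on_subset)
qed

lemma uniform_copy_weight:
  assumes E: "E \<subseteq> [{..<n}]\<^bsup>2\<^esup>"
  shows "uniform_weight ([{..<N}]\<^bsup>2\<^esup>) (card E) (copy_weight n N E)"
  unfolding uniform_weight_def
proof (intro conjI allI impI)
  fix f
  show "0 \<le> copy_weight n N E f" by (simp add: copy_weight_def)
  assume "copy_weight n N E f \<noteq> 0"
  then have "{\<phi> \<in> embeddings n N. (`) \<phi> ` E = f} \<noteq> {}" unfolding copy_weight_def by force
  then obtain \<phi> where \<phi>: "\<phi> \<in> embeddings n N" "(`) \<phi> ` E = f" by blast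
  show "f \<subseteq> [{..<N}]\<^bsup>2\<^esup>" using copy_subset_pairs[OF \<phi>(1) E] \<phi>(2) by simp
  show "card f = card E" using card_image[OF inj_on_image_edges[OF \<phi>(1) E]] \<phi>(2) by simp
qed

text \<open>Taking \<open>N\<close> as a perfect power makes \<open>1 / m\<close> equal to
  N^(-1/\<Delta>) without real roots. A set \<open>s\<close> spanning the vertex set
  \<open>U\<close> lies in at most \<open>n ^ n * N ^ (n - card U)\<close> copies; compared with
  \<open>N ^ n / N\<^sup>2\<close> the claim becomes an inequality between powers of
  \<open>m\<close>, which is \<open>card_edges_le\<close>.\<close>

lemma copy_weight_spread:
  assumes \<Delta>: "2 \<le> \<Delta>" and E: "E \<subseteq> [{..<n}]\<^bsup>2\<^esup>" and deg: "\<And>i. card {e \<in> E. i \<in> e} \<le> \<Delta>"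
    and m: "1 \<le> m" and N: "N = m ^ \<Delta>" and s: "s \<noteq> {}"
  shows "wdeg ([{..<N}]\<^bsup>2\<^esup>) (copy_weight n N E) s
     \<le> (1 / real m) ^ (card s - 1) * (real n ^ n * real N ^ n / (real N)\<^sup>2)"
proof -
  have fin: "finite ([{..<N}]\<^bsup>2\<^esup>)" by (simp add: finite_imp_finite_nsets)
  let ?S = "{\<phi> \<in> embeddings n N. s \<subseteq> (`) \<phi> ` E \<and> (`) \<phi> ` E \<subseteq> [{..<N}]\<^bsup>2\<^esup>}"
  show ?thesis
  proof (cases "?S = {}")
    case True
    show ?thesis unfolding wdeg_copy_weight[OF fin] True by simp
  next
    case False
    \<comment> \<open>A single embedding whose image contains \<open>s\<close> is enough to
      transport the degree bound from \<open>E\<close> to \<open>s\<close>.\<close>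
    then obtain \<phi> where \<phi>: "\<phi> \<in> embeddings n N" and sub: "s \<subseteq> (`) \<phi> ` E" by blast
    define U where "U = \<Union>s"
    have finE: "finite E" using E finite_subset finite_imp_finite_nsets by blast
    then have fins: "finite s" using sub finite_subset by blast
    have sp: "s \<subseteq> [{..<N}]\<^bsup>2\<^esup>" using sub copy_subset_pairs[OF \<phi> E] by blast
    have Urange: "\<Union>s \<subseteq> \<psi> ` {..<n}" if "s \<subseteq> (`) \<psi> ` E" for \<psi>
      using that E by (fastforce simp: nsets_def)
    have finU: "finite U" using Urange[OF sub] finite_subset unfolding U_def by blast
    have Un: "card U \<le> n"
      using Urange[OF sub] surj_card_le[of "{..<n}" U \<phi>] by (simp add: U_def)
    have "card s + 2 * \<Delta> \<le> 1 + \<Delta> * card U"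
      unfolding U_def
    proof (rule card_edges_le[OF fins _ _ \<Delta> s])
      show "card e = 2" if "e \<in> s" for e using that sp by (auto simp: nsets_def)
      show "card {e \<in> s. x \<in> e} \<le> \<Delta>" for x
      proof (cases "x \<in> \<phi> ` {..<n}")
        case True
        then obtain i where i: "i < n" "x = \<phi> i" by auto
        have "{e \<in> s. x \<in> e} \<subseteq> (`) \<phi> ` {e \<in> E. i \<in> e}"
        proof
          fix e assume "e \<in> {e \<in> s. x \<in> e}"
          then obtain e' where e': "e' \<in> E" "e = \<phi> ` e'" "\<phi> i \<in> \<phi> ` e'" using sub i by auto
          have "e' \<subseteq> {..<n}" using e' E by (auto simp: nsets_def)
          then have "i \<in> e'" using e'(3) i \<phi> by (auto simp: embeddings_def dest: inj_onD)
          then show "e \<in> (`) \<phi> ` {e \<in> E. i \<in> e}" using e' by blast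
        qed
        then have "card {e \<in> s. x \<in> e} \<le> card {e \<in> E. i \<in> e}"
          using finE by (intro surj_card_le) auto
        then show ?thesis using deg[of i] by linarith
      next
        case False
        then have "{e \<in> s. x \<in> e} = {}" using Urange[OF sub] by blast
        then show ?thesis by (simp only: card.empty)
      qed
    qed
    then have exponent: "card s - 1 + \<Delta> * (2 + (n - card U)) \<le> \<Delta> * n"
    proof -
      assume le: "card s + 2 * \<Delta> \<le> 1 + \<Delta> * card U"
      have "\<Delta> * n = \<Delta> * card U + \<Delta> * (n - card U)"
        using Un by (simp flip: distrib_left)
      moreover have "\<Delta> * (2 + (n - card U)) = 2 * \<Delta> + \<Delta> * (n - card U)"
        by (simp add: distrib_left)
      moreover have "1 \<le> card s" using fins s by (simp add: Suc_leI card_gt_0_iff)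
      ultimately show ?thesis using le by linarith
    qed
    have "real m ^ (card s - 1) * ((real N)\<^sup>2 * real N ^ (n - card U)) \<le> real N ^ n"
    proof -
      have "real m ^ (card s - 1) * ((real N)\<^sup>2 * real N ^ (n - card U))
          = real m ^ (card s - 1 + \<Delta> * (2 + (n - card U)))"
        by (simp only: N of_nat_power power_mult power_add)
      also have "\<dots> \<le> real m ^ (\<Delta> * n)" using exponent m by (intro power_increasing) auto
      also have "\<dots> = real N ^ n" by (simp only: N of_nat_power power_mult)
      finally show ?thesis .
    qed
    then have key: "real N ^ (n - card U) \<le> (1 / real m) ^ (card s - 1) * (real N ^ n / (real N)\<^sup>2)"
      using m N by (simp add: field_simps)
    have "card ?S \<le> card {\<phi> \<in> embeddings n N. U \<subseteq> \<phi> ` {..<n}}"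
      using Urange finite_embeddings unfolding U_def by (intro card_mono) auto
    also have "\<dots> \<le> n ^ card U * N ^ (n - card U)" by (rule card_embeddings_onto_le[OF finU])
    also have "\<dots> \<le> n ^ n * N ^ (n - card U)"
    proof (cases "n = 0")
      case False
      then show ?thesis using Un by (intro mult_right_mono power_increasing) auto
    qed (use Un in auto)
    finally have "real (card ?S) \<le> real (n ^ n * N ^ (n - card U))" by (rule of_nat_mono)
    also have "\<dots> = real n ^ n * real N ^ (n - card U)" by simp
    also have "\<dots> \<le> real n ^ n * ((1 / real m) ^ (card s - 1) * (real N ^ n / (real N)\<^sup>2))"
      using key by (rule mult_left_mono) simp
    finally show ?thesis unfolding wdeg_copy_weight[OF fin] by (simp add: mult_ac)
  qed
qed

definition copy_containers :: "nat \<Rightarrow> nat \<Rightarrow> real \<Rightarrow> nat set set \<Rightarrow> nat set set set \<Rightarrow> bool" where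
  "copy_containers n N \<epsilon> E \<C> \<longleftrightarrow> finite \<C> \<and>
     (\<forall>C\<in>\<C>. real (card {\<phi> \<in> embeddings n N. (`) \<phi> ` E \<subseteq> C}) \<le> \<epsilon> * real N ^ n) \<and>
     (\<forall>I. I \<subseteq> [{..<N}]\<^bsup>2\<^esup> \<longrightarrow> (\<forall>\<phi>\<in>embeddings n N. \<not> (`) \<phi> ` E \<subseteq> I) \<longrightarrow> (\<exists>C\<in>\<C>. I \<subseteq> C))"

text \<open>\<open>container\<close> is applied to the pairs of \<open>{..<N}\<close> with
  \<open>\<tau> = 1 / m\<close>, where \<open>N\<^sup>2\<close> bounds the size of the ground set.
  The constant \<open>K\<close> is fixed before \<open>m\<close>, \<open>N\<close> and
  \<open>L\<close>, so the parameters can be tuned to it later.\<close>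

lemma copy_containers_exist:
  assumes \<Delta>: "2 \<le> \<Delta>" and E: "E \<subseteq> [{..<n}]\<^bsup>2\<^esup>" and deg: "\<And>i. card {e \<in> E. i \<in> e} \<le> \<Delta>"
    and \<epsilon>: "0 < \<epsilon>"
  shows "\<exists>K. \<forall>m N L. 1 \<le> m \<longrightarrow> N = m ^ \<Delta> \<longrightarrow> 2 * (real N)\<^sup>2 / real m + 1 \<le> real L \<longrightarrow>
     (\<exists>\<C>. copy_containers n N \<epsilon> E \<C> \<and> card \<C> \<le> (N\<^sup>2 + 1) ^ (K * L))"
proof -
  \<comment> \<open>Dividing \<open>\<epsilon>\<close> by \<open>n ^ n\<close> cancels this factor
    in \<open>D\<close>, so that \<open>\<epsilon>' * D * N\<^sup>2\<close> is
    \<open>\<epsilon> * N ^ n\<close>. For \<open>n = 0\<close> the factor is 1.\<close>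
  have nn: "0 < real n ^ n" by (cases "n = 0") auto
  define \<epsilon>' where "\<epsilon>' = \<epsilon> / real n ^ n"
  have \<epsilon>': "0 < \<epsilon>'" using \<epsilon> nn by (simp add: \<epsilon>'_def)
  obtain K where K: "\<forall>(V :: nat set set) w \<tau> D n L.
    finite V \<longrightarrow> card V \<le> n \<longrightarrow> 1 \<le> n \<longrightarrow> 0 < \<tau> \<longrightarrow> 0 < D \<longrightarrow> 2 * \<tau> * real n + 1 \<le> real L \<longrightarrow>
    uniform_weight V (card E) w \<longrightarrow>
    (\<forall>s. s \<subseteq> V \<longrightarrow> s \<noteq> {} \<longrightarrow> wdeg V w s \<le> \<tau> ^ (card s - 1) * D) \<longrightarrow>
    (\<exists>\<C>. container_family V w \<C> \<and> card \<C> \<le> (n + 1) ^ (K * L) \<and>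
       (\<forall>C\<in>\<C>. wdeg C w {} \<le> \<epsilon>' * D * real n))"
    using container[OF \<epsilon>', of "card E"] by (elim exE)
  have "\<exists>\<C>. copy_containers n N \<epsilon> E \<C> \<and> card \<C> \<le> (N\<^sup>2 + 1) ^ (K * L)"
    if m: "1 \<le> m" and N: "N = m ^ \<Delta>" and L: "2 * (real N)\<^sup>2 / real m + 1 \<le> real L" for m N L
  proof -
    let ?V = "[{..<N}]\<^bsup>2\<^esup>" and ?w = "copy_weight n N E"
    define D where "D = real n ^ n * real N ^ n / (real N)\<^sup>2"
    have N0: "1 \<le> N" using m N by simp
    have D0: "0 < D" using nn N0 by (simp add: D_def)
    have finV: "finite ?V" by (simp add: finite_imp_finite_nsets)
    have "N choose 2 \<le> N * (N - 1)" unfolding choose_two by (rule div_le_dividend)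
    also have "\<dots> \<le> N\<^sup>2" by (simp add: power2_eq_square)
    finally have "N choose 2 \<le> N\<^sup>2" .
    then have cV: "card ?V \<le> N\<^sup>2" by simp
    have N2: "1 \<le> N\<^sup>2" using N0 by simp
    have L': "2 * (1 / real m) * real (N\<^sup>2) + 1 \<le> real L" using L by simp
    have "\<exists>\<C>. container_family ?V ?w \<C> \<and> card \<C> \<le> (N\<^sup>2 + 1) ^ (K * L) \<and>
       (\<forall>C\<in>\<C>. wdeg C ?w {} \<le> \<epsilon>' * D * real (N\<^sup>2))"
      by (intro K[rule_format, OF finV cV N2 _ D0 L' uniform_copy_weight[OF E]])
        (use m copy_weight_spread[OF \<Delta> E deg m N] in \<open>auto simp: D_def\<close>)
    then obtain \<C> where fam: "container_family ?V ?w \<C>" and card: "card \<C> \<le> (N\<^sup>2 + 1) ^ (K * L)"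
      and small: "\<And>C. C \<in> \<C> \<Longrightarrow> wdeg C ?w {} \<le> \<epsilon>' * D * real (N\<^sup>2)" by blast
    have "\<epsilon>' * D * real (N\<^sup>2) = \<epsilon> * real N ^ n"
      using nn N0 by (simp add: \<epsilon>'_def D_def)
    moreover have "finite C" if "C \<in> \<C>" for C
      using fam that finV by (auto simp: container_family_def intro: finite_subset)
    ultimately have few: "real (card {\<phi> \<in> embeddings n N. (`) \<phi> ` E \<subseteq> C}) \<le> \<epsilon> * real N ^ n"
      if "C \<in> \<C>" for C
      using small[OF that] that by (simp add: wdeg_copy_weight)
    have "\<exists>C\<in>\<C>. I \<subseteq> C" if I: "I \<subseteq> ?V" "\<forall>\<phi>\<in>embeddings n N. \<not> (`) \<phi> ` E \<subseteq> I" for I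
    proof -
      have "?w f = 0" if "f \<subseteq> I" for f
      proof -
        have "{\<phi> \<in> embeddings n N. (`) \<phi> ` E = f} = {}" using I(2) that by blast
        then show ?thesis by (simp only: copy_weight_def card.empty)
      qed
      then show ?thesis using fam I(1) by (simp add: container_family_def)
    qed
    then have "copy_containers n N \<epsilon> E \<C>"
      using fam few by (simp add: copy_containers_def container_family_def)
    then show ?thesis using card by blast
  qed
  then show ?thesis by (intro exI[of _ K] allI impI)
qed

text \<open>There are finitely many edge sets on \<open>{..<n}\<close>, so their container families
  can be united. Each embedded clique contains an embedded copy of every \<open>E\<close>, which
  replaces the separate bounds by one on cliques.\<close>

lemma bounded_degree_containers:
  assumes \<Delta>: "2 \<le> \<Delta>" and \<epsilon>: "0 < \<epsilon>"
  shows "\<exists>K. \<forall>m N L. 1 \<le> m \<longrightarrow> N = m ^ \<Delta> \<longrightarrow> 2 * (real N)\<^sup>2 / real m + 1 \<le> real L \<longrightarrow>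
     (\<exists>\<C>. finite \<C> \<and> card \<C> \<le> (N\<^sup>2 + 1) ^ (K * L) \<and>
       (\<forall>C\<in>\<C>. real (card {\<phi> \<in> embeddings n N. (`) \<phi> ` [{..<n}]\<^bsup>2\<^esup> \<subseteq> C}) \<le> \<epsilon> * real N ^ n) \<and>
       (\<forall>I E. I \<subseteq> [{..<N}]\<^bsup>2\<^esup> \<longrightarrow> E \<subseteq> [{..<n}]\<^bsup>2\<^esup> \<longrightarrow> (\<forall>i. card {e \<in> E. i \<in> e} \<le> \<Delta>) \<longrightarrow>
          (\<forall>\<phi>\<in>embeddings n N. \<not> (`) \<phi> ` E \<subseteq> I) \<longrightarrow> (\<exists>C\<in>\<C>. I \<subseteq> C)))"
proof -
  define \<E> where "\<E> = {E. E \<subseteq> [{..<n}]\<^bsup>2\<^esup> \<and> (\<forall>i. card {e \<in> E. i \<in> e} \<le> \<Delta>)}"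
  have fin: "finite \<E>"
    by (rule finite_subset[of _ "Pow ([{..<n}]\<^bsup>2\<^esup>)"]) (auto simp: \<E>_def finite_imp_finite_nsets)
  have "\<exists>K. \<forall>m N L. 1 \<le> m \<longrightarrow> N = m ^ \<Delta> \<longrightarrow> 2 * (real N)\<^sup>2 / real m + 1 \<le> real L \<longrightarrow>
     (\<exists>\<C>. copy_containers n N \<epsilon> E \<C> \<and> card \<C> \<le> (N\<^sup>2 + 1) ^ (K * L))" if "E \<in> \<E>" for E
    by (rule copy_containers_exist[OF \<Delta> _ _ \<epsilon>]) (use that in \<open>auto simp: \<E>_def\<close>)
  then obtain K where K: "\<And>E m N L. E \<in> \<E> \<Longrightarrow> 1 \<le> m \<Longrightarrow> N = m ^ \<Delta> \<Longrightarrow>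
      2 * (real N)\<^sup>2 / real m + 1 \<le> real L \<Longrightarrow>
      \<exists>\<C>. copy_containers n N \<epsilon> E \<C> \<and> card \<C> \<le> (N\<^sup>2 + 1) ^ (K E * L)" by metis
  \<comment> \<open>The summand \<open>card \<E>\<close> pays for the number of families, since
    \<open>card \<E> \<le> 2 ^ card \<E>\<close> and the base \<open>N\<^sup>2 + 1\<close> is at
    least 2.\<close>
  define K' where "K' = (\<Sum>E\<in>\<E>. K E) + card \<E>"
  have "\<exists>\<C>. finite \<C> \<and> card \<C> \<le> (N\<^sup>2 + 1) ^ (K' * L) \<and>
       (\<forall>C\<in>\<C>. real (card {\<phi> \<in> embeddings n N. (`) \<phi> ` [{..<n}]\<^bsup>2\<^esup> \<subseteq> C}) \<le> \<epsilon> * real N ^ n) \<and>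
       (\<forall>I E. I \<subseteq> [{..<N}]\<^bsup>2\<^esup> \<longrightarrow> E \<subseteq> [{..<n}]\<^bsup>2\<^esup> \<longrightarrow> (\<forall>i. card {e \<in> E. i \<in> e} \<le> \<Delta>) \<longrightarrow>
          (\<forall>\<phi>\<in>embeddings n N. \<not> (`) \<phi> ` E \<subseteq> I) \<longrightarrow> (\<exists>C\<in>\<C>. I \<subseteq> C))"
    if m: "1 \<le> m" and N: "N = m ^ \<Delta>" and L: "2 * (real N)\<^sup>2 / real m + 1 \<le> real L" for m N L
  proof -
    obtain \<C> where fam: "\<And>E. E \<in> \<E> \<Longrightarrow> copy_containers n N \<epsilon> E (\<C> E)"
      and cardC: "\<And>E. E \<in> \<E> \<Longrightarrow> card (\<C> E) \<le> (N\<^sup>2 + 1) ^ (K E * L)"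
      using K[OF _ m N L] by metis
    define \<D> where "\<D> = (\<Union>E\<in>\<E>. \<C> E)"
    have "finite \<D>" using fin fam by (auto simp: \<D>_def copy_containers_def)
    moreover have "card \<D> \<le> (N\<^sup>2 + 1) ^ (K' * L)"
    proof -
      have N1: "2 \<le> N\<^sup>2 + 1" using m N by simp
      have "0 \<le> 2 * (real N)\<^sup>2 / real m" by simp
      then have "0 < L" using L by linarith
      have "card \<D> \<le> (\<Sum>E\<in>\<E>. card (\<C> E))" unfolding \<D>_def by (rule card_UN_le[OF fin])
      also have "\<dots> \<le> (\<Sum>E\<in>\<E>. (N\<^sup>2 + 1) ^ ((\<Sum>E\<in>\<E>. K E) * L))"
      proof (rule sum_mono)
        fix E assume E: "E \<in> \<E>"
        have "K E \<le> (\<Sum>E\<in>\<E>. K E)" using fin E by (intro member_le_sum) auto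
        then have "(N\<^sup>2 + 1) ^ (K E * L) \<le> (N\<^sup>2 + 1) ^ ((\<Sum>E\<in>\<E>. K E) * L)"
          by (intro power_increasing mult_right_mono) auto
        then show "card (\<C> E) \<le> (N\<^sup>2 + 1) ^ ((\<Sum>E\<in>\<E>. K E) * L)" using cardC[OF E] by linarith
      qed
      also have "\<dots> = card \<E> * (N\<^sup>2 + 1) ^ ((\<Sum>E\<in>\<E>. K E) * L)" by simp
      also have "\<dots> \<le> (N\<^sup>2 + 1) ^ (card \<E> * L) * (N\<^sup>2 + 1) ^ ((\<Sum>E\<in>\<E>. K E) * L)"
      proof (rule mult_right_mono)
        have "card \<E> \<le> 2 ^ card \<E>" by (rule less_imp_le[OF less_exp])
        also have "\<dots> \<le> (N\<^sup>2 + 1) ^ card \<E>" using N1 by (intro power_mono) auto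
        also have "\<dots> \<le> (N\<^sup>2 + 1) ^ (card \<E> * L)" using \<open>0 < L\<close> by (intro power_increasing) auto
        finally show "card \<E> \<le> (N\<^sup>2 + 1) ^ (card \<E> * L)" .
      qed simp
      also have "\<dots> = (N\<^sup>2 + 1) ^ (card \<E> * L + (\<Sum>E\<in>\<E>. K E) * L)" by (simp only: power_add)
      also have "card \<E> * L + (\<Sum>E\<in>\<E>. K E) * L = K' * L" by (simp add: K'_def distrib_right)
      finally show ?thesis .
    qed
    moreover have "real (card {\<phi> \<in> embeddings n N. (`) \<phi> ` [{..<n}]\<^bsup>2\<^esup> \<subseteq> C}) \<le> \<epsilon> * real N ^ n"
      if C: "C \<in> \<D>" for C
    proof -
      obtain E where E: "E \<in> \<E>" "C \<in> \<C> E" using C unfolding \<D>_def by blast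
      have "E \<subseteq> [{..<n}]\<^bsup>2\<^esup>" using E by (simp add: \<E>_def)
      then have "{\<phi> \<in> embeddings n N. (`) \<phi> ` [{..<n}]\<^bsup>2\<^esup> \<subseteq> C} \<subseteq> {\<phi> \<in> embeddings n N. (`) \<phi> ` E \<subseteq> C}"
        by blast
      then have "card {\<phi> \<in> embeddings n N. (`) \<phi> ` [{..<n}]\<^bsup>2\<^esup> \<subseteq> C}
          \<le> card {\<phi> \<in> embeddings n N. (`) \<phi> ` E \<subseteq> C}"
        using finite_embeddings by (intro card_mono) auto
      moreover have "real (card {\<phi> \<in> embeddings n N. (`) \<phi> ` E \<subseteq> C}) \<le> \<epsilon> * real N ^ n"
        using fam[OF E(1)] E(2) by (simp add: copy_containers_def)
      ultimately show ?thesis by linarith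
    qed
    moreover have "\<exists>C\<in>\<D>. I \<subseteq> C"
      if I: "I \<subseteq> [{..<N}]\<^bsup>2\<^esup>" and E: "E \<subseteq> [{..<n}]\<^bsup>2\<^esup>" "\<forall>i. card {e \<in> E. i \<in> e} \<le> \<Delta>"
        and free: "\<forall>\<phi>\<in>embeddings n N. \<not> (`) \<phi> ` E \<subseteq> I" for I E
    proof -
      have E': "E \<in> \<E>" using E by (simp add: \<E>_def)
      then have "\<exists>C\<in>\<C> E. I \<subseteq> C" using fam[OF E'] I free unfolding copy_containers_def by blast
      then show ?thesis using E' unfolding \<D>_def by blast
    qed
    ultimately show ?thesis by (intro exI[of _ \<D>] conjI allI impI ballI)
  qed
  then show ?thesis by (intro exI[of _ K'] allI impI)
qed

subsection \<open>Random graphs with alterations\<close>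

text \<open>The probability that a binomial random subset of \<open>E\<close> contains
  \<open>K\<close>, as a finite sum. Once \<open>K\<close> is split off, the rest is the expansion
  of a product of factors \<open>p + (1 - p)\<close>.\<close>

lemma sum_random_subset:
  fixes p :: real
  assumes "finite E" "K \<subseteq> E"
  shows "(\<Sum>G | G \<subseteq> E \<and> K \<subseteq> G. p ^ card G * (1 - p) ^ card (E - G)) = p ^ card K"
proof -
  have fK: "finite K" using assms finite_subset by blast
  have "(\<Sum>G | G \<subseteq> E \<and> K \<subseteq> G. p ^ card G * (1 - p) ^ card (E - G))
      = (\<Sum>X\<in>Pow (E - K). p ^ card K * (p ^ card X * (1 - p) ^ card (E - K - X)))"
  proof (rule sum.reindex_bij_witness[of _ "\<lambda>X. X \<union> K" "\<lambda>G. G - K"])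
    fix G assume G: "G \<in> {G. G \<subseteq> E \<and> K \<subseteq> G}"
    then have "finite G" using assms finite_subset by blast
    then have "card G = card K + card (G - K)" using G fK
      by (simp add: card_Diff_subset card_mono)
    moreover have "E - K - (G - K) = E - G" using G by auto
    ultimately show "p ^ card K * (p ^ card (G - K) * (1 - p) ^ card (E - K - (G - K)))
       = p ^ card G * (1 - p) ^ card (E - G)" by (simp add: power_add)
  qed (use assms in auto)
  also have "\<dots> = p ^ card K * (\<Sum>X\<in>Pow (E - K). p ^ card X * (1 - p) ^ card (E - K - X))"
    by (simp add: sum_distrib_left)
  also have "(\<Sum>X\<in>Pow (E - K). p ^ card X * (1 - p) ^ card (E - K - X)) = (\<Prod>x\<in>E - K. p + (1 - p))"
    using prod_add[of "E - K" "\<lambda>_. p" "\<lambda>_. 1 - p"] assms(1) by simp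
  finally show ?thesis by simp
qed

text \<open>The expectation of 2 to the power of minus \<open>card (G \<inter> D)\<close>. By
  Markov's inequality, \<open>2 ^ s\<close> times this value bounds the probability that
  \<open>G\<close> meets \<open>D\<close> in at most \<open>s\<close> elements, so it takes the
  place of a Chernoff bound.\<close>

lemma sum_random_subset_half:
  fixes p :: real
  assumes "finite E" "D \<subseteq> E"
  shows "(\<Sum>G\<in>Pow E. p ^ card G * (1 - p) ^ card (E - G) * (1 / 2) ^ card (G \<inter> D)) = (1 - p / 2) ^ card D"
proof -
  have "(\<Prod>x\<in>E. (if x \<in> D then p / 2 else p) + (1 - p))
     = (\<Sum>G\<in>Pow E. (\<Prod>x\<in>G. if x \<in> D then p / 2 else p) * (\<Prod>x\<in>E - G. 1 - p))"
    by (rule prod_add[OF assms(1)])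
  also have "\<dots> = (\<Sum>G\<in>Pow E. p ^ card G * (1 - p) ^ card (E - G) * (1 / 2) ^ card (G \<inter> D))"
  proof (rule sum.cong[OF refl])
    fix G assume "G \<in> Pow E"
    then have f: "finite G" using assms finite_subset by blast
    have "(\<Prod>x\<in>G. if x \<in> D then p / 2 else p) = (\<Prod>x\<in>G. p * (if x \<in> D then 1 / 2 else 1))"
      by (rule prod.cong) auto
    also have "\<dots> = p ^ card G * (1 / 2) ^ card (G \<inter> D)"
      using f by (simp add: prod.distrib prod.If_cases)
    finally show "(\<Prod>x\<in>G. if x \<in> D then p / 2 else p) * (\<Prod>x\<in>E - G. 1 - p)
       = p ^ card G * (1 - p) ^ card (E - G) * (1 / 2) ^ card (G \<inter> D)" by simp
  qed
  also have "(\<Prod>x\<in>E. (if x \<in> D then p / 2 else p) + (1 - p)) = (\<Prod>x\<in>E. if x \<in> D then 1 - p / 2 else 1)"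
    by (rule prod.cong) auto
  also have "\<dots> = (1 - p / 2) ^ card D"
  proof -
    have "E \<inter> D = D" using assms by auto
    then show ?thesis using assms by (simp add: prod.If_cases)
  qed
  finally show ?thesis by simp
qed

text \<open>Some \<open>G\<close> contains fewer than \<open>s\<close> members of
  \<open>\<K>\<close> and meets each \<open>D\<close> in more than \<open>s\<close> elements.
  Deleting one element from every member of \<open>\<K>\<close> inside \<open>G\<close> then leaves
  each intersection non-empty.\<close>

lemma alteration:
  fixes p :: real and s d h :: nat
  assumes E: "finite E" and p: "0 \<le> p" "p \<le> 1" and s: "0 < s"
    and K: "finite \<K>" "\<And>K. K \<in> \<K> \<Longrightarrow> K \<subseteq> E \<and> K \<noteq> {} \<and> card K = h"
    and D: "finite \<D>" "\<And>D. D \<in> \<D> \<Longrightarrow> D \<subseteq> E \<and> d \<le> card D"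
    and less: "real (card \<K>) * p ^ h / real s + real (card \<D>) * 2 ^ s * (1 - p / 2) ^ d < 1"
  shows "\<exists>G. G \<subseteq> E \<and> (\<forall>K\<in>\<K>. \<not> K \<subseteq> G) \<and> (\<forall>D\<in>\<D>. G \<inter> D \<noteq> {})"
proof -
  define wt where "wt G = p ^ card G * (1 - p) ^ card (E - G)" for G
  have wt0: "0 \<le> wt G" for G using p by (simp add: wt_def)
  define X where "X G = card {K \<in> \<K>. K \<subseteq> G}" for G
  \<comment> \<open>Each failure contributes at least 1 to \<open>bad G\<close>: a first summand of
    1 means \<open>s\<close> forbidden sets, and an intersection of size at most \<open>s\<close>
    makes its term at least 1. So an expectation below 1 excludes all failures for some
    \<open>G\<close>.\<close>
  define bad where "bad G = real (X G) / real s + (\<Sum>D\<in>\<D>. 2 ^ s * (1 / 2) ^ card (G \<inter> D))" for G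
  have tot: "(\<Sum>G\<in>Pow E. wt G) = 1"
    using sum_random_subset[OF E, of "{}" p] by (simp add: wt_def Pow_def)
  have EX: "(\<Sum>G\<in>Pow E. wt G * real (X G)) = real (card \<K>) * p ^ h"
  proof -
    have "(\<Sum>G\<in>Pow E. wt G * real (X G)) = (\<Sum>G\<in>Pow E. \<Sum>K\<in>\<K>. if K \<subseteq> G then wt G else 0)"
    proof (rule sum.cong[OF refl])
      fix G
      show "wt G * real (X G) = (\<Sum>K\<in>\<K>. if K \<subseteq> G then wt G else 0)"
        using K(1) by (simp add: X_def sum.inter_filter[symmetric] mult.commute)
    qed
    also have "\<dots> = (\<Sum>K\<in>\<K>. \<Sum>G\<in>Pow E. if K \<subseteq> G then wt G else 0)" by (rule sum.swap)
    also have "\<dots> = (\<Sum>K\<in>\<K>. p ^ h)"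
    proof (rule sum.cong[OF refl])
      fix K' assume K': "K' \<in> \<K>"
      have "(\<Sum>G\<in>Pow E. if K' \<subseteq> G then wt G else 0) = (\<Sum>G | G \<subseteq> E \<and> K' \<subseteq> G. wt G)"
        using E by (subst sum.inter_filter[symmetric]) auto
      then show "(\<Sum>G\<in>Pow E. if K' \<subseteq> G then wt G else 0) = p ^ h"
        using sum_random_subset[OF E, of K' p] K(2)[OF K'] by (simp add: wt_def)
    qed
    finally show ?thesis by simp
  qed
  have "(\<Sum>G\<in>Pow E. wt G * bad G)
      = (\<Sum>G\<in>Pow E. wt G * real (X G)) / real s
        + (\<Sum>G\<in>Pow E. \<Sum>D\<in>\<D>. 2 ^ s * (wt G * (1 / 2) ^ card (G \<inter> D)))"
    by (simp add: bad_def distrib_left sum.distrib sum_divide_distrib sum_distrib_left mult_ac)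
  also have "(\<Sum>G\<in>Pow E. \<Sum>D\<in>\<D>. 2 ^ s * (wt G * (1 / 2) ^ card (G \<inter> D)))
      = (\<Sum>D\<in>\<D>. 2 ^ s * (\<Sum>G\<in>Pow E. wt G * (1 / 2) ^ card (G \<inter> D)))"
    by (subst sum.swap) (simp add: sum_distrib_left)
  also have "\<dots> = (\<Sum>D\<in>\<D>. 2 ^ s * (1 - p / 2) ^ card D)"
    using D(2) by (intro sum.cong refl) (simp add: wt_def sum_random_subset_half[OF E])
  also have "\<dots> \<le> (\<Sum>D\<in>\<D>. 2 ^ s * (1 - p / 2) ^ d)"
    using D(2) p by (intro sum_mono mult_left_mono power_decreasing) auto
  finally have "(\<Sum>G\<in>Pow E. wt G * bad G) < 1"
    using less by (simp add: EX mult_ac)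
  moreover have "(\<Sum>G\<in>Pow E. wt G * 1) \<le> (\<Sum>G\<in>Pow E. wt G * bad G)"
    if "\<And>G. G \<subseteq> E \<Longrightarrow> 1 \<le> bad G"
    using that wt0 by (intro sum_mono mult_left_mono) auto
  ultimately have "\<not> (\<forall>G. G \<subseteq> E \<longrightarrow> 1 \<le> bad G)" using tot by auto
  then obtain G where G: "G \<subseteq> E" "bad G < 1" by (auto simp: not_le)
  have finG: "finite G" using G E finite_subset by blast
  have "real (X G) / real s < 1"
  proof -
    have "0 \<le> (\<Sum>D\<in>\<D>. 2 ^ s * (1 / 2) ^ card (G \<inter> D) :: real)" by (intro sum_nonneg) auto
    then show ?thesis using G(2) by (simp add: bad_def)
  qed
  then have Xs: "X G < s" using s by (simp add: field_simps)
  have many: "s < card (G \<inter> D)" if "D \<in> \<D>" for D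
  proof (rule ccontr)
    assume "\<not> s < card (G \<inter> D)"
    then have "2 ^ card (G \<inter> D) \<le> (2::real) ^ s" by (intro power_increasing) auto
    then have "1 \<le> 2 ^ s * (1 / 2 :: real) ^ card (G \<inter> D)" by (simp add: power_one_over field_simps)
    also have "\<dots> \<le> (\<Sum>D\<in>\<D>. 2 ^ s * (1 / 2) ^ card (G \<inter> D))"
      using D(1) that by (intro member_le_sum[of D \<D> "\<lambda>D. 2 ^ s * (1 / 2 :: real) ^ card (G \<inter> D)"]) auto
    also have "\<dots> \<le> bad G" by (simp add: bad_def)
    finally show False using G(2) by simp
  qed
  define c where "c K = (SOME e. e \<in> K)" for K :: "'a set"
  have c: "c K \<in> K" if "K \<in> \<K>" for K using K(2)[OF that] by (simp add: c_def some_in_eq)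
  define R where "R = c ` {K \<in> \<K>. K \<subseteq> G}"
  have "card R < s" using Xs card_image_le[of "{K \<in> \<K>. K \<subseteq> G}" c] K(1) by (simp add: R_def X_def)
  have finR: "finite R" using K(1) by (simp add: R_def)
  have "\<not> K' \<subseteq> G - R" if "K' \<in> \<K>" for K' using c[OF that] that by (auto simp: R_def)
  moreover have "(G - R) \<inter> D \<noteq> {}" if "D \<in> \<D>" for D
  proof
    assume "(G - R) \<inter> D = {}"
    then have "G \<inter> D \<subseteq> R" by auto
    then have "card (G \<inter> D) \<le> card R" using finR card_mono by blast
    then show False using many[OF that] \<open>card R < s\<close> by simp
  qed
  ultimately show ?thesis using G(1) by (intro exI[of _ "G - R"]) auto
qed

subsection \<open>Transfer to graphs\<close>

lemma degree_le_max_degree: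
  assumes "finite_simple_graph H" "v \<in> verts H"
  shows "degree H v \<le> max_degree H"
  using assms unfolding max_degree_def finite_simple_graph_def by (intro Max_ge) auto

text \<open>A bijection \<open>h\<close> from \<open>{..<n}\<close> to the vertices pulls the edges
  back to a labelled copy on \<open>{..<n}\<close>, the only form in which the counting sees
  \<open>H\<close>. Isolated vertices are not lost, because embeddings are defined on all of
  \<open>{..<n}\<close>.\<close>

lemma bounded_degree_edge_set:
  assumes H: "H \<in> bounded_degree_graphs n \<Delta>"
  shows "\<exists>E. E \<subseteq> [{..<n}]\<^bsup>2\<^esup> \<and> (\<forall>i. card {e \<in> E. i \<in> e} \<le> \<Delta>) \<and>
    (\<forall>N I \<phi>. \<phi> \<in> embeddings n N \<longrightarrow> (`) \<phi> ` E \<subseteq> I \<longrightarrow> contains_copy (Graph {..<N} I) H)"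
proof -
  have fin: "finite (verts H)" and simple: "\<And>e. e \<in> edges H \<Longrightarrow> e \<subseteq> verts H \<and> card e = 2"
    and n: "card (verts H) = n" and deg: "max_degree H \<le> \<Delta>" and fsg: "finite_simple_graph H"
    using H by (auto simp: bounded_degree_graphs_def finite_simple_graph_def)
  obtain h where h: "bij_betw h {..<n} (verts H)"
    using ex_bij_betw_nat_finite[OF fin] n by (auto simp: atLeast0LessThan)
  have hinj: "inj_on h {..<n}" and himg: "h ` {..<n} = verts H" using h by (auto simp: bij_betw_def)
  define E where "E = {e \<in> [{..<n}]\<^bsup>2\<^esup>. h ` e \<in> edges H}"
  have E: "E \<subseteq> [{..<n}]\<^bsup>2\<^esup>" by (auto simp: E_def)
  have Esub: "e \<subseteq> {..<n}" if "e \<in> E" for e using that E by (auto simp: nsets_def)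
  have surj: "(`) h ` E = edges H"
  proof
    show "edges H \<subseteq> (`) h ` E"
    proof
      fix e assume e: "e \<in> edges H"
      then obtain e' where e': "e' \<subseteq> {..<n}" "e = h ` e'" using simple himg by (metis subset_imageE)
      then have "card e' = 2" using simple[OF e] hinj by (metis card_image inj_on_subset)
      then have "e' \<in> E" using e e' by (auto simp: E_def nsets_def intro: finite_subset)
      then show "e \<in> (`) h ` E" using e' by blast
    qed
  qed (auto simp: E_def)
  have finE: "finite (edges H)"
    by (rule finite_subset[of _ "Pow (verts H)"]) (use simple fin in auto)
  have degE: "card {e \<in> E. i \<in> e} \<le> \<Delta>" for i
  proof (cases "i < n")
    case True
    have "inj_on ((`) h) {e \<in> E. i \<in> e}"
      using hinj Esub by (intro inj_on_subset[OF inj_on_image_Pow[OF hinj]]) auto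
    moreover have "(`) h ` {e \<in> E. i \<in> e} \<subseteq> {e \<in> edges H. h i \<in> e}" by (auto simp: E_def)
    ultimately have "card {e \<in> E. i \<in> e} \<le> degree H (h i)"
      unfolding degree_def using finE by (intro card_inj_on_le) auto
    also have "\<dots> \<le> max_degree H"
      using himg True by (intro degree_le_max_degree[OF fsg]) auto
    finally show ?thesis using deg by linarith
  next
    case False
    then have "{e \<in> E. i \<in> e} = {}" using Esub by blast
    then show ?thesis by (simp only: card.empty)
  qed
  have copy: "contains_copy (Graph {..<N} I) H"
    if \<phi>: "\<phi> \<in> embeddings n N" and sub: "(`) \<phi> ` E \<subseteq> I" for N I \<phi>
  proof -
    have \<phi>inj: "inj_on \<phi> {..<n}" and \<phi>img: "\<phi> ` {..<n} \<subseteq> {..<N}" using \<phi> by (auto simp: embeddings_def)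
    define S where "S = Graph (\<phi> ` {..<n}) ((`) \<phi> ` E)"
    have "finite_simple_graph S"
      unfolding finite_simple_graph_def
    proof (intro conjI ballI)
      fix e assume "e \<in> edges S"
      then obtain e' where e': "e' \<in> E" "e = \<phi> ` e'" by (auto simp: S_def)
      then show "e \<subseteq> verts S" using Esub by (auto simp: S_def)
      show "card e = 2"
        using card_image[OF inj_on_subset[OF \<phi>inj Esub[OF e'(1)]]] e' E by (auto simp: nsets_def)
    qed (simp add: S_def)
    then have "subgraph S (Graph {..<N} I)" using \<phi>img sub by (auto simp: subgraph_def S_def)
    moreover have "isomorphic S H"
      unfolding isomorphic_def
    proof (intro exI conjI)
      let ?f = "h \<circ> inv_into {..<n} \<phi>"
      have "bij_betw \<phi> {..<n} (\<phi> ` {..<n})" using \<phi>inj by (simp add: bij_betw_def)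
      then show "bij_betw ?f (verts S) (verts H)"
        unfolding S_def using bij_betw_trans[OF bij_betw_inv_into h] by simp
      have "?f ` (\<phi> ` e) = h ` e" if "e \<in> E" for e
        using Esub[OF that] \<phi>inj by (force simp: image_image inv_into_f_f)
      then have "(\<lambda>e. ?f ` e) ` edges S = (`) h ` E" by (auto simp: S_def image_image)
      then show "(\<lambda>e. ?f ` e) ` edges S = edges H" using surj by simp
    qed
    ultimately show ?thesis unfolding contains_copy_def by blast
  qed
  show ?thesis using E degE copy by (intro exI[of _ E] conjI allI impI)
qed

section \<open>Bicliques as forbidden edge sets\<close>

text \<open>Indexing by vertex maps yields the bound \<open>N ^ (2 * t)\<close>; the two conditions
  on \<open>K\<close> are those that \<open>alteration\<close> puts on forbidden sets, a place in
  the ground set and a common size.\<close>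

definition biclique_copies :: "nat \<Rightarrow> nat \<Rightarrow> nat set set set" where
  "biclique_copies t N = {K \<in> (\<lambda>g. (`) g ` edges (complete_bipartite t t)) ` (({..<t} <+> {..<t}) \<rightarrow>\<^sub>E {..<N}).
      K \<subseteq> [{..<N}]\<^bsup>2\<^esup> \<and> card K = t\<^sup>2}"

lemma finite_biclique_copies: "finite (biclique_copies t N)"
  and card_biclique_copies_le: "card (biclique_copies t N) \<le> N ^ (2 * t)"
proof -
  define \<G> where "\<G> = (({..<t} <+> {..<t}) \<rightarrow>\<^sub>E {..<N})"
  have fin: "finite \<G>" unfolding \<G>_def by (intro finite_PiE) auto
  have sub: "biclique_copies t N \<subseteq> (\<lambda>g. (`) g ` edges (complete_bipartite t t)) ` \<G>"
    unfolding biclique_copies_def \<G>_def by (rule Collect_restrict)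
  then show "finite (biclique_copies t N)" using fin finite_subset by blast
  have "card (biclique_copies t N) \<le> card \<G>" using fin sub by (rule surj_card_le)
  also have "\<dots> = N ^ (2 * t)" unfolding \<G>_def by (simp add: card_funcsetE card_Plus mult_2)
  finally show "card (biclique_copies t N) \<le> N ^ (2 * t)" .
qed

lemma card_edges_complete_bipartite: "card (edges (complete_bipartite s t)) = s * t"
proof -
  have "edges (complete_bipartite s t) = (\<lambda>(i, j). {Inl i, Inr j}) ` ({..<s} \<times> {..<t})"
    by (auto simp: complete_bipartite_def)
  moreover have "inj_on (\<lambda>(i, j). {Inl i, Inr j} :: (nat + nat) set) ({..<s} \<times> {..<t})"
    by (auto simp: inj_on_def doubleton_eq_iff)
  ultimately show ?thesis by (simp add: card_image)
qed

text \<open>The isomorphism runs from the copy to the biclique, so its inverse, made extensional, is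
  the map that exhibits the edges of the copy as a member of \<open>biclique_copies\<close>.\<close>

lemma biclique_copy_subset:
  assumes "contains_copy (Graph {..<N} G) (complete_bipartite t t)"
    and G: "G \<subseteq> [{..<N}]\<^bsup>2\<^esup>"
  shows "\<exists>K\<in>biclique_copies t N. K \<subseteq> G"
proof -
  let ?B = "complete_bipartite t t"
  have vB: "verts ?B = {..<t} <+> {..<t}" by (simp add: complete_bipartite_def)
  have eB: "e \<subseteq> verts ?B" if "e \<in> edges ?B" for e
    using that by (auto simp: complete_bipartite_def)
  obtain S f where S: "subgraph S (Graph {..<N} G)" and f: "bij_betw f (verts S) (verts ?B)"
    and fe: "(`) f ` edges S = edges ?B"
    using assms(1) by (auto simp: contains_copy_def isomorphic_def)
  have Sv: "verts S \<subseteq> {..<N}" and Se: "edges S \<subseteq> G" and simple: "\<And>e. e \<in> edges S \<Longrightarrow> e \<subseteq> verts S"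
    using S by (auto simp: subgraph_def finite_simple_graph_def)
  define g where "g = restrict (inv_into (verts S) f) (verts ?B)"
  have ginj: "inj_on g (verts ?B)"
    unfolding g_def using bij_betw_imp_inj_on[OF bij_betw_inv_into[OF f]] by (simp add: inj_on_def)
  have gimg: "g ` verts ?B = verts S"
    unfolding g_def using bij_betw_imp_surj_on[OF bij_betw_inv_into[OF f]] by simp
  have gmem: "g \<in> ({..<t} <+> {..<t}) \<rightarrow>\<^sub>E {..<N}"
    using gimg Sv unfolding vB[symmetric] by (auto simp: g_def)
  have gf: "g ` (f ` e) = e" if "e \<in> edges S" for e
  proof -
    have "g (f x) = x" if "x \<in> verts S" for x
      using f that by (auto simp: g_def bij_betw_def inv_into_f_f)
    then show ?thesis using simple[OF that] by (force simp: image_image)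
  qed
  have eq: "(`) g ` edges ?B = edges S"
  proof -
    have "(`) g ` edges ?B = (\<lambda>e. g ` (f ` e)) ` edges S"
      unfolding fe[symmetric] by (rule image_image)
    also have "\<dots> = (\<lambda>e. e) ` edges S" by (rule image_cong[OF refl gf])
    finally show ?thesis by simp
  qed
  have "inj_on ((`) g) (edges ?B)"
    using eB by (intro inj_on_subset[OF inj_on_image_Pow[OF ginj]]) auto
  then have "card (edges S) = t\<^sup>2"
    by (simp add: eq[symmetric] card_image card_edges_complete_bipartite power2_eq_square)
  moreover have "edges S \<in> (\<lambda>g. (`) g ` edges ?B) ` (({..<t} <+> {..<t}) \<rightarrow>\<^sub>E {..<N})"
    using eq gmem by (intro image_eqI[of _ _ g]) simp_all
  ultimately have "edges S \<in> biclique_copies t N"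
    using Se G by (simp add: biclique_copies_def)
  then show ?thesis using Se by blast
qed

section \<open>Choice of parameters\<close>

lemma eventually_linear_dominates_ln:
  fixes c b \<epsilon> :: real
  assumes "0 < \<epsilon>"
  shows "\<exists>q0::nat. \<forall>q\<ge>q0. c * ln (real q) + b \<le> \<epsilon> * real q"
proof -
  have "((\<lambda>x. c * (ln x / x) + b * inverse x) \<longlongrightarrow> c * 0 + b * 0) at_top"
    by (intro tendsto_add tendsto_mult tendsto_const ln_x_over_x_tendsto_0 tendsto_inverse_0_at_top filterlim_ident)
  then have "((\<lambda>q. c * (ln (real q) / real q) + b * inverse (real q)) \<longlongrightarrow> 0) sequentially"
    using filterlim_compose[OF _ filterlim_real_sequentially] by fastforce
  then have "eventually (\<lambda>q. c * (ln (real q) / real q) + b * inverse (real q) < \<epsilon>) sequentially"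
    using assms by (rule order_tendstoD(2))
  then obtain q0 where q0: "\<And>q. q0 \<le> q \<Longrightarrow> c * (ln (real q) / real q) + b * inverse (real q) < \<epsilon>"
    by (auto simp: eventually_sequentially)
  have "c * ln (real q) + b \<le> \<epsilon> * real q" if "Suc q0 \<le> q" for q
  proof -
    have "0 < real q" using that by simp
    moreover have "c * (ln (real q) / real q) + b * inverse (real q) < \<epsilon>" using q0 that by simp
    ultimately show ?thesis by (simp add: field_simps)
  qed
  then show ?thesis by blast
qed

text \<open>
  With \<open>N = q ^ (4 * \<Delta>\<^sup>2)\<close>, \<open>m = q ^ (4 * \<Delta>)\<close> and density \<open>p = q / m\<close>, the expected number of copies of
  the biclique is at most \<open>N\<close>, while the expected number of edges exceeds the logarithm of the
  number of containers by a factor of order \<open>q / ln q\<close>.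
\<close>

lemma parameters_exist:
  fixes \<epsilon> :: real and K r \<Delta> N0 :: nat
  assumes \<Delta>: "2 \<le> \<Delta>" and \<epsilon>: "0 < \<epsilon>"
  shows "\<exists>m N L s p. 1 \<le> m \<and> N = m ^ \<Delta> \<and> N0 \<le> N \<and> 2 * (real N)\<^sup>2 / real m + 1 \<le> real L \<and>
     0 \<le> p \<and> p \<le> 1 \<and> 0 < s \<and>
     real (N ^ (2 * (2 * \<Delta>))) * p ^ (2 * \<Delta>)\<^sup>2 / real s
       + real (((N\<^sup>2 + 1) ^ (K * L)) ^ r) * 2 ^ s * (1 - p / 2) ^ nat \<lceil>\<epsilon> * (real N)\<^sup>2\<rceil> < 1"
proof -
  \<comment> \<open>By \<open>N\<^sup>2 + 1 \<le> q ^ (8 * \<Delta>\<^sup>2 + 1)\<close> and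
    \<open>L \<le> 3 * A\<close>, the number of \<open>r\<close>-tuples of containers has logarithm
    at most \<open>A * (c * ln q)\<close>.\<close>
  define c where "c = 3 * real ((8 * \<Delta>\<^sup>2 + 1) * K * r)"
  \<comment> \<open>Of the 6, a share of 4 pays for \<open>2 ^ s\<close>, as
    \<open>s = 4 * N \<le> 4 * A\<close>, and 2 leaves the margin \<open>exp (- 2)\<close>.\<close>
  obtain q0 where q0: "\<And>q. q0 \<le> q \<Longrightarrow> c * ln (real q) + 6 \<le> \<epsilon> / 2 * real q"
    using eventually_linear_dominates_ln[of "\<epsilon> / 2" c 6] \<epsilon> by auto
  define q where "q = max (max q0 N0) 2"
  have q: "q0 \<le> q" "N0 \<le> q" "2 \<le> q" by (auto simp: q_def)
  define m where "m = q ^ (4 * \<Delta>)"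
  define N where "N = m ^ \<Delta>"
  \<comment> \<open>This is \<open>N\<^sup>2 / m\<close> as a natural number. It makes
    \<open>2 * A + 1\<close> the least admissible \<open>L\<close>, and
    \<open>p * N\<^sup>2 = q * A\<close>.\<close>
  define A where "A = q ^ (8 * \<Delta>\<^sup>2 - 4 * \<Delta>)"
  define L where "L = 2 * A + 1"
  \<comment> \<open>Four times the bound \<open>N\<close> on the expected number of bicliques, so
    that the Markov term is at most \<open>1 / 4\<close>.\<close>
  define s where "s = 4 * N"
  define d where "d = nat \<lceil>\<epsilon> * (real N)\<^sup>2\<rceil>"
  define p where "p = real q / real m"
  have \<Delta>\<Delta>: "2 * \<Delta> \<le> \<Delta>\<^sup>2" using \<Delta> by (simp add: power2_eq_square)
  have Nq: "N = q ^ (4 * \<Delta>\<^sup>2)" by (simp add: N_def m_def power2_eq_square mult.assoc flip: power_mult)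
  have m1: "1 \<le> m" using q by (simp add: m_def)
  have "q ^ 1 \<le> N" unfolding Nq using q \<Delta> by (intro power_increasing) auto
  then have N1: "q \<le> N" by simp
  have Am: "real A * real m = (real N)\<^sup>2"
  proof -
    have "A * m = q ^ (8 * \<Delta>\<^sup>2 - 4 * \<Delta> + 4 * \<Delta>)" by (simp only: A_def m_def power_add)
    also have "8 * \<Delta>\<^sup>2 - 4 * \<Delta> + 4 * \<Delta> = 4 * \<Delta>\<^sup>2 * 2" using \<Delta>\<Delta> by simp
    also have "q ^ (4 * \<Delta>\<^sup>2 * 2) = N\<^sup>2" by (simp only: Nq power_mult)
    finally show ?thesis by (metis of_nat_mult of_nat_power)
  qed
  have A1: "1 \<le> A" using q by (simp add: A_def)
  have NA: "N \<le> A" unfolding Nq A_def using q \<Delta>\<Delta> by (intro power_increasing) auto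
  have L: "2 * (real N)\<^sup>2 / real m + 1 \<le> real L" using Am m1 by (simp add: L_def flip: Am)
  have "q ^ 1 \<le> m" unfolding m_def using q \<Delta> by (intro power_increasing) auto
  then have p: "0 \<le> p" "p \<le> 1" using m1 by (auto simp: p_def)
  have first: "real (N ^ (2 * (2 * \<Delta>))) * p ^ (2 * \<Delta>)\<^sup>2 / real s \<le> 1 / 4"
  proof -
    \<comment> \<open>The exponent in \<open>N = q ^ (4 * \<Delta>\<^sup>2)\<close> is the number of
      edges of the biclique: the numerators of \<open>p\<close> multiply to exactly
      \<open>N\<close>, and the powers of \<open>m\<close> cancel the number of vertex maps.\<close>
    have "p ^ (2 * \<Delta>)\<^sup>2 = real N / real N ^ (4 * \<Delta>)"
    proof -
      have "real q ^ (2 * \<Delta>)\<^sup>2 = real N" by (simp add: Nq power_mult_distrib)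
      moreover have "real m ^ (2 * \<Delta>)\<^sup>2 = real N ^ (4 * \<Delta>)"
        by (simp add: N_def power2_eq_square mult_ac flip: power_mult)
      ultimately show ?thesis by (simp add: p_def power_divide)
    qed
    then show ?thesis using N1 q by (simp add: s_def)
  qed
  have second: "real (((N\<^sup>2 + 1) ^ (K * L)) ^ r) * 2 ^ s * (1 - p / 2) ^ d \<le> exp (- 2)"
  proof -
    have q0': "0 < real q" using q by simp
    have "real (((N\<^sup>2 + 1) ^ (K * L)) ^ r) \<le> exp (real A * (c * ln (real q)))"
    proof -
      have "N\<^sup>2 + 1 \<le> 2 * N\<^sup>2" using N1 q by simp
      also have "\<dots> \<le> q * N\<^sup>2" using q by (intro mult_right_mono) auto
      also have "\<dots> = q ^ (8 * \<Delta>\<^sup>2 + 1)" by (simp add: Nq flip: power_mult)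
      finally have "((N\<^sup>2 + 1) ^ (K * L)) ^ r \<le> ((q ^ (8 * \<Delta>\<^sup>2 + 1)) ^ (K * L)) ^ r"
        by (intro power_mono) auto
      also have "\<dots> = q ^ ((8 * \<Delta>\<^sup>2 + 1) * K * r * L)"
        by (simp only: power_mult[symmetric] mult_ac)
      also have "\<dots> \<le> q ^ ((8 * \<Delta>\<^sup>2 + 1) * K * r * (3 * A))"
        using q A1 by (intro power_increasing mult_left_mono) (auto simp: L_def)
      finally have "real (((N\<^sup>2 + 1) ^ (K * L)) ^ r) \<le> real (q ^ ((8 * \<Delta>\<^sup>2 + 1) * K * r * (3 * A)))"
        by (rule of_nat_mono)
      also have "\<dots> = exp (ln (real q) * real ((8 * \<Delta>\<^sup>2 + 1) * K * r * (3 * A)))"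
        using q0' by (simp only: of_nat_power exp_of_nat2_mult exp_ln)
      also have "ln (real q) * real ((8 * \<Delta>\<^sup>2 + 1) * K * r * (3 * A)) = real A * (c * ln (real q))"
        by (simp only: c_def of_nat_mult of_nat_numeral mult_ac)
      finally show ?thesis .
    qed
    moreover have "(2::real) ^ s \<le> exp (real A * 4)"
    proof -
      have "(2::real) ^ s \<le> exp 1 ^ s" using exp_ge_add_one_self[of 1] by (intro power_mono) auto
      also have "\<dots> = exp (real s)" by (simp flip: exp_of_nat_mult)
      also have "\<dots> \<le> exp (real A * 4)" using NA by (simp add: s_def)
      finally show ?thesis .
    qed
    moreover have "(1 - p / 2) ^ d \<le> exp (- (real A * (\<epsilon> / 2 * real q)))"
    proof -
      have "(1 - p / 2) ^ d \<le> exp (- (p / 2)) ^ d"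
        using p exp_ge_add_one_self[of "- (p / 2)"] by (intro power_mono) auto
      also have "\<dots> = exp (real d * (- (p / 2)))" by (simp only: exp_of_nat_mult)
      also have "\<dots> \<le> exp (- (real A * (\<epsilon> / 2 * real q)))"
      proof -
        have "\<epsilon> * (real N)\<^sup>2 * (p / 2) \<le> real d * (p / 2)"
          using p by (intro mult_right_mono) (simp_all add: d_def of_nat_ceiling)
        moreover have "\<epsilon> * (real N)\<^sup>2 * (p / 2) = real A * (\<epsilon> / 2 * real q)"
          using m1 by (simp add: p_def flip: Am)
        ultimately have "real A * (\<epsilon> / 2 * real q) \<le> real d * (p / 2)" by linarith
        then show ?thesis by (simp only: exp_le_cancel_iff mult_minus_right neg_le_iff_le)
      qed
      finally show ?thesis .
    qed
    ultimately have "real (((N\<^sup>2 + 1) ^ (K * L)) ^ r) * 2 ^ s * (1 - p / 2) ^ d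
        \<le> exp (real A * (c * ln (real q))) * exp (real A * 4) * exp (- (real A * (\<epsilon> / 2 * real q)))"
      using p by (intro mult_mono) auto
    also have "\<dots> = exp (real A * (c * ln (real q) + 4 - \<epsilon> / 2 * real q))"
      by (simp add: algebra_simps flip: exp_add)
    also have "\<dots> \<le> exp (1 * (- 2))"
    proof -
      have "c * ln (real q) + 4 - \<epsilon> / 2 * real q \<le> - 2" using q0[OF q(1)] by linarith
      then have "real A * (c * ln (real q) + 4 - \<epsilon> / 2 * real q) \<le> real A * (- 2)"
        by (intro mult_left_mono) auto
      also have "\<dots> \<le> 1 * (- 2)" using A1 by simp
      finally show ?thesis by simp
    qed
    finally show ?thesis by simp
  qed
  have "exp (- 2) \<le> (1 / 3 :: real)"
    using exp_ge_add_one_self[of "2::real"] by (simp add: exp_minus field_simps)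
  then have "real (N ^ (2 * (2 * \<Delta>))) * p ^ (2 * \<Delta>)\<^sup>2 / real s
       + real (((N\<^sup>2 + 1) ^ (K * L)) ^ r) * 2 ^ s * (1 - p / 2) ^ d < 1"
    using first second by linarith
  moreover have "0 < s" "N0 \<le> N" using N1 q by (auto simp: s_def)
  ultimately show ?thesis using m1 N_def L p unfolding d_def by blast
qed


theorem theorem1p5:
  fixes r \<Delta> n :: nat
  assumes "\<Delta> \<ge> 2"
  shows "\<exists>G :: nat graph. finite_simple_graph G \<and>
           \<not> contains_copy G (complete_bipartite (2 * \<Delta>) (2 * \<Delta>)) \<and>
           partition_universal r G (bounded_degree_graphs n \<Delta>)"
proof -
  obtain \<epsilon> N0 where \<epsilon>: "0 < \<epsilon>" and super: "\<forall>N\<ge>N0. \<forall>C.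
     (\<forall>i<r. real (card {\<phi> \<in> embeddings n N. (`) \<phi> ` [{..<n}]\<^bsup>2\<^esup> \<subseteq> C i}) \<le> \<epsilon> * real N ^ n) \<longrightarrow>
     \<epsilon> * (real N)\<^sup>2 \<le> real (card ([{..<N}]\<^bsup>2\<^esup> - (\<Union>i<r. C i)))"
    using clique_supersaturation[of r n] by (elim exE conjE)
  obtain K where K: "\<forall>m N L. 1 \<le> m \<longrightarrow> N = m ^ \<Delta> \<longrightarrow> 2 * (real N)\<^sup>2 / real m + 1 \<le> real L \<longrightarrow>
     (\<exists>\<C>. finite \<C> \<and> card \<C> \<le> (N\<^sup>2 + 1) ^ (K * L) \<and>
       (\<forall>C\<in>\<C>. real (card {\<phi> \<in> embeddings n N. (`) \<phi> ` [{..<n}]\<^bsup>2\<^esup> \<subseteq> C}) \<le> \<epsilon> * real N ^ n) \<and>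
       (\<forall>I E. I \<subseteq> [{..<N}]\<^bsup>2\<^esup> \<longrightarrow> E \<subseteq> [{..<n}]\<^bsup>2\<^esup> \<longrightarrow> (\<forall>i. card {e \<in> E. i \<in> e} \<le> \<Delta>) \<longrightarrow>
          (\<forall>\<phi>\<in>embeddings n N. \<not> (`) \<phi> ` E \<subseteq> I) \<longrightarrow> (\<exists>C\<in>\<C>. I \<subseteq> C)))"
    using bounded_degree_containers[OF assms \<epsilon>, of n] by (elim exE)
  obtain m N L s p where m: "1 \<le> m" and N: "N = m ^ \<Delta>" and NN: "N0 \<le> N"
    and L: "2 * (real N)\<^sup>2 / real m + 1 \<le> real L" and p: "0 \<le> p" "p \<le> 1" and s: "0 < s"
    and small: "real (N ^ (2 * (2 * \<Delta>))) * p ^ (2 * \<Delta>)\<^sup>2 / real s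
       + real (((N\<^sup>2 + 1) ^ (K * L)) ^ r) * 2 ^ s * (1 - p / 2) ^ nat \<lceil>\<epsilon> * (real N)\<^sup>2\<rceil> < 1"
    using parameters_exist[OF assms \<epsilon>, of N0 K r] by (elim exE conjE)
  obtain \<C> where fin: "finite \<C>" and card: "card \<C> \<le> (N\<^sup>2 + 1) ^ (K * L)"
    and few: "\<forall>C\<in>\<C>.
       real (card {\<phi> \<in> embeddings n N. (`) \<phi> ` [{..<n}]\<^bsup>2\<^esup> \<subseteq> C}) \<le> \<epsilon> * real N ^ n"
    and cover: "\<forall>I E. I \<subseteq> [{..<N}]\<^bsup>2\<^esup> \<longrightarrow> E \<subseteq> [{..<n}]\<^bsup>2\<^esup> \<longrightarrow> (\<forall>i. card {e \<in> E. i \<in> e} \<le> \<Delta>) \<longrightarrow>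
       (\<forall>\<phi>\<in>embeddings n N. \<not> (`) \<phi> ` E \<subseteq> I) \<longrightarrow> (\<exists>C\<in>\<C>. I \<subseteq> C)"
    using K[rule_format, OF m N L] by (elim exE conjE)
  \<comment> \<open>For \<open>r = 0\<close> the only member is the set of all pairs. Meeting it
    gives \<open>G\<close> an edge, so that no colouring without colours exists.\<close>
  define \<D> where "\<D> = (\<lambda>C. [{..<N}]\<^bsup>2\<^esup> - (\<Union>i<r. C i)) ` ({..<r} \<rightarrow>\<^sub>E \<C>)"
  have finF: "finite ({..<r} \<rightarrow>\<^sub>E \<C>)" using fin by (intro finite_PiE) auto
  have finp: "finite ([{..<N}]\<^bsup>2\<^esup>)" by (simp add: finite_imp_finite_nsets)
  have "\<exists>G. G \<subseteq> [{..<N}]\<^bsup>2\<^esup> \<and> (\<forall>K\<in>biclique_copies (2 * \<Delta>) N. \<not> K \<subseteq> G) \<and> (\<forall>D\<in>\<D>. G \<inter> D \<noteq> {})"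
  proof (rule alteration[OF finp p s finite_biclique_copies])
    show "K \<subseteq> [{..<N}]\<^bsup>2\<^esup> \<and> K \<noteq> {} \<and> card K = (2 * \<Delta>)\<^sup>2" if "K \<in> biclique_copies (2 * \<Delta>) N" for K
    proof -
      have "K \<subseteq> [{..<N}]\<^bsup>2\<^esup>" "card K = (2 * \<Delta>)\<^sup>2" using that by (simp_all add: biclique_copies_def)
      moreover from this(2) have "K \<noteq> {}" using assms by auto
      ultimately show ?thesis by blast
    qed
    show "finite \<D>" using finF by (simp add: \<D>_def)
    show "D \<subseteq> [{..<N}]\<^bsup>2\<^esup> \<and> nat \<lceil>\<epsilon> * (real N)\<^sup>2\<rceil> \<le> card D" if "D \<in> \<D>" for D
    proof -
      obtain C where C: "\<And>i. i < r \<Longrightarrow> C i \<in> \<C>" and D: "D = [{..<N}]\<^bsup>2\<^esup> - (\<Union>i<r. C i)"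
        using \<open>D \<in> \<D>\<close> by (auto simp: \<D>_def PiE_iff)
      have "\<epsilon> * (real N)\<^sup>2 \<le> real (card D)" unfolding D using C by (intro super[rule_format, OF NN] few[rule_format])
      then show ?thesis unfolding D by (simp add: nat_le_iff ceiling_le_iff)
    qed
    have "card \<D> \<le> card ({..<r} \<rightarrow>\<^sub>E \<C>)" unfolding \<D>_def using finF by (rule card_image_le)
    also have "\<dots> = card \<C> ^ r" by (simp add: card_funcsetE)
    also have "\<dots> \<le> ((N\<^sup>2 + 1) ^ (K * L)) ^ r" using card by (rule power_mono) simp
    finally have cD: "card \<D> \<le> ((N\<^sup>2 + 1) ^ (K * L)) ^ r" .
    have "real (card (biclique_copies (2 * \<Delta>) N)) * p ^ (2 * \<Delta>)\<^sup>2 / real s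
        \<le> real (N ^ (2 * (2 * \<Delta>))) * p ^ (2 * \<Delta>)\<^sup>2 / real s"
      by (intro divide_right_mono mult_right_mono of_nat_mono card_biclique_copies_le
          zero_le_power p of_nat_0_le_iff)
    moreover have "real (card \<D>) * 2 ^ s * (1 - p / 2) ^ nat \<lceil>\<epsilon> * (real N)\<^sup>2\<rceil>
        \<le> real (((N\<^sup>2 + 1) ^ (K * L)) ^ r) * 2 ^ s * (1 - p / 2) ^ nat \<lceil>\<epsilon> * (real N)\<^sup>2\<rceil>"
    proof -
      have "0 \<le> 1 - p / 2" using p by simp
      then show ?thesis
        by (intro mult_right_mono of_nat_mono cD zero_le_power zero_le_numeral)
    qed
    ultimately show "real (card (biclique_copies (2 * \<Delta>) N)) * p ^ (2 * \<Delta>)\<^sup>2 / real s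
        + real (card \<D>) * 2 ^ s * (1 - p / 2) ^ nat \<lceil>\<epsilon> * (real N)\<^sup>2\<rceil> < 1"
      using small by linarith
  qed
  then obtain G where G: "G \<subseteq> [{..<N}]\<^bsup>2\<^esup>" and free: "\<forall>K\<in>biclique_copies (2 * \<Delta>) N. \<not> K \<subseteq> G"
    and hit: "\<forall>D\<in>\<D>. G \<inter> D \<noteq> {}" by (elim exE conjE)
  have "finite_simple_graph (Graph {..<N} G)"
    using G by (auto simp: finite_simple_graph_def nsets_def)
  moreover have "\<not> contains_copy (Graph {..<N} G) (complete_bipartite (2 * \<Delta>) (2 * \<Delta>))"
    using biclique_copy_subset[OF _ G] free by blast
  moreover have "partition_universal r (Graph {..<N} G) (bounded_degree_graphs n \<Delta>)"
    unfolding partition_universal_def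
  proof (intro ballI, rule ccontr)
    fix c assume c: "c \<in> edges (Graph {..<N} G) \<rightarrow> {..<r}"
    define I where "I i = {e \<in> G. c e = i}" for i
    have class_eq: "colour_class (Graph {..<N} G) c i = Graph {..<N} (I i)" for i
      by (simp add: colour_class_def I_def)
    assume "\<not> (\<exists>i<r. \<forall>H\<in>bounded_degree_graphs n \<Delta>. contains_copy (colour_class (Graph {..<N} G) c i) H)"
    then have miss: "\<exists>H\<in>bounded_degree_graphs n \<Delta>. \<not> contains_copy (Graph {..<N} (I i)) H" if "i < r" for i
      using that by (auto simp: class_eq)
    have "\<exists>C\<in>\<C>. I i \<subseteq> C" if i: "i < r" for i
    proof -
      obtain H where H: "H \<in> bounded_degree_graphs n \<Delta>" "\<not> contains_copy (Graph {..<N} (I i)) H"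
        using miss[OF i] by blast
      obtain E where E: "E \<subseteq> [{..<n}]\<^bsup>2\<^esup>" "\<forall>i. card {e \<in> E. i \<in> e} \<le> \<Delta>"
        and copy: "\<forall>N I \<phi>. \<phi> \<in> embeddings n N \<longrightarrow> (`) \<phi> ` E \<subseteq> I \<longrightarrow> contains_copy (Graph {..<N} I) H"
        using bounded_degree_edge_set[OF H(1)] by (elim exE conjE)
      show ?thesis
      proof (rule cover[rule_format, OF _ E(1) E(2)[rule_format]])
        show "I i \<subseteq> [{..<N}]\<^bsup>2\<^esup>" using G by (auto simp: I_def)
        show "\<not> (`) \<phi> ` E \<subseteq> I i" if "\<phi> \<in> embeddings n N" for \<phi>
          using copy[rule_format, OF that] H(2) by blast
      qed
    qed
    then obtain C where C: "\<And>i. i < r \<Longrightarrow> C i \<in> \<C> \<and> I i \<subseteq> C i" by metis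
    have "[{..<N}]\<^bsup>2\<^esup> - (\<Union>i<r. C i) = [{..<N}]\<^bsup>2\<^esup> - (\<Union>i<r. restrict C {..<r} i)" by simp
    moreover have "restrict C {..<r} \<in> {..<r} \<rightarrow>\<^sub>E \<C>" using C by simp
    ultimately have "[{..<N}]\<^bsup>2\<^esup> - (\<Union>i<r. C i) \<in> \<D>" unfolding \<D>_def by (rule image_eqI)
    \<comment> \<open>The edge \<open>e\<close> escapes all \<open>r\<close> containers, yet the
      class of its own colour lies in one of them.\<close>
    then obtain e where e: "e \<in> G" "e \<notin> (\<Union>i<r. C i)" using hit by blast
    then have "c e < r" using c by auto
    then have "e \<in> C (c e)" using C e(1) by (auto simp: I_def)
    then show False using e(2) \<open>c e < r\<close> by blast
  qed
  ultimately show ?thesis by blast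
qed

end
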